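(* For integers $n,r\ge 1$ let $K_{n,r}$ denote the number of connected $n$ cell degree $r$ networks, counted up to isomorphism, and let $M_{n,r}$ denote the number of minimal connected $n$ cell degree $r$ networks, counted up to isomorphism. Then for every $n\ge 2$ we have $M_{n,1}=K_{n,1}$ and, for every $r\ge 2$, $$M_{n,r}=K_{n,r}-\sum_{s=1}^{r-1}\left\lfloor \frac{r}{s}\right\rfloor M_{n,s}.$$ For $n=1$ we have $M_{1,r}=0$ for all $r\ge 1$.
   Context: An $n$ cell degree $r$ network ($n\ge 1$, $r\ge 0$) is a directed multigraph, loops allowed, on a vertex set $V$ with $|V|=n$, given by an edge multiplicity function $E:V\times V\to\mathbb{N}=\{0,1,2,\dots\}$ ($E(u,v)$ is the number of edges from $u$ to $v$), such that every vertex has in-degree $r$: $\sum_{u\in V}E(u,v)=r$ for all $v\in V$. Two networks are isomorphic if a bijection of their vertex sets carries one edge multiplicity function to the other. A network is connected if its underlying undirected graph is connected. Admissible vector fields: take $V=\{1,\dots,n\}$ and a phase space $P=\mathbb{R}^d$, $d\ge1$. For a degree $r$ network $G$ on $V$, $\mathfrak{X}_G^P$ is the set of all vector fields on $P^n$ of the form $\dot x_i=F(x_i;x_{j^{(i)}_1},\dots,x_{j^{(i)}_r})$, $1\le i\le n$, where $j^{(i)}_1,\dots,j^{(i)}_r$ are the source vertices (with multiplicity) of the $r$ edges terminating at $i$, and $F:P\times P^r\to P$ is a smooth function such that $F(x;y_1,\dots,y_r)$ is invariant under all permutations of $y_1,\dots,y_r$. Two networks $G_1,G_2$ with the same number $n$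 of vertices are O.D.E. equivalent if there is a network $G_2'$ isomorphic to $G_2$ (on the vertex set of $G_1$) such that $\mathfrak{X}_{G_1}^P=\mathfrak{X}_{G_2'}^P$ for all phase spaces $P=\mathbb{R}^d$. A network is minimal if its number of edges is minimal among all networks in its O.D.E. equivalence class (equivalently, since the number of vertices is fixed, its degree is minimal). Degree $0$ (edgeless) networks are allowed in this comparison. *)

theory Defs
  imports "HOL-Analysis.Analysis" "HOL-Combinatorics.Permutations"
begin

text \<open>An \<open>n\<close> cell network lives on the vertex set \<open>{1..n}\<close> and is identified with its edge
  multiplicity function; multiplicities outside the vertex set are fixed to be \<open>0\<close>, so that distinct
  functions are distinct networks.\<close>

type_synonym network = "nat \<Rightarrow> nat \<Rightarrow> nat"

definition networks :: "nat \<Rightarrow> nat \<Rightarrow> network set" where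
  "networks n r = {E. (\<forall>u v. u \<notin> {1..n} \<or> v \<notin> {1..n} \<longrightarrow> E u v = 0) \<and>
                      (\<forall>v\<in>{1..n}. (\<Sum>u\<in>{1..n}. E u v) = r)}"

definition network_iso :: "nat \<Rightarrow> network \<Rightarrow> network \<Rightarrow> bool" where
  "network_iso n E E' \<longleftrightarrow>
     (\<exists>\<phi>. bij_betw \<phi> {1..n} {1..n} \<and> (\<forall>u\<in>{1..n}. \<forall>v\<in>{1..n}. E' (\<phi> u) (\<phi> v) = E u v))"

definition connected_network :: "nat \<Rightarrow> network \<Rightarrow> bool" where
  "connected_network n E \<longleftrightarrow>
     (\<forall>u\<in>{1..n}. \<forall>v\<in>{1..n}.
        (u, v) \<in> {(a, b). a \<in> {1..n} \<and> b \<in> {1..n} \<and> (E a b > 0 \<or> E b a > 0)}\<^sup>*)"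

definition num_edges :: "nat \<Rightarrow> network \<Rightarrow> nat" where
  "num_edges n E = (\<Sum>u\<in>{1..n}. \<Sum>v\<in>{1..n}. E u v)"

text \<open>Since the dimension of the phase space is quantified inside the definition of O.D.E.
  equivalence, it cannot be a type. For finite \<open>I\<close>, the space of real vectors indexed by \<open>I\<close> is
  represented by the functions vanishing outside \<open>I\<close>, following the convention of
  \<^const>\<open>Euclidean_space\<close>. Its topology is the one induced by the product topology on the
  function type.\<close>

definition coord_space :: "'i set \<Rightarrow> ('i \<Rightarrow> real) set" where
  "coord_space I = {x. \<forall>i. i \<notin> I \<longrightarrow> x i = 0}"

abbreviation phase_space :: "nat \<Rightarrow> (nat \<Rightarrow> real) set" where
  "phase_space d \<equiv> coord_space {..<d}"

lemma phase_space_eq_topspace: "phase_space d = topspace (Euclidean_space d)"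
  by (auto simp: coord_space_def topspace_Euclidean_space)

text \<open>\<open>C_diff k I f\<close>: all iterated partial derivatives of \<open>f\<close> of order at most \<open>k\<close> exist and
  are continuous.\<close>

primrec C_diff :: "nat \<Rightarrow> 'i set \<Rightarrow> (('i \<Rightarrow> real) \<Rightarrow> real) \<Rightarrow> bool" where
  "C_diff 0 I f \<longleftrightarrow> continuous_on (coord_space I) f"
| "C_diff (Suc k) I f \<longleftrightarrow>
     continuous_on (coord_space I) f \<and>
     (\<forall>i\<in>I. \<exists>g. C_diff k I g \<and>
        (\<forall>x\<in>coord_space I. ((\<lambda>t. f (x(i := t))) has_real_derivative g x) (at (x i))))"

definition C_infinity :: "'i set \<Rightarrow> (('i \<Rightarrow> real) \<Rightarrow> real) \<Rightarrow> bool" where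
  "C_infinity I f \<longleftrightarrow> (\<forall>k. C_diff k I f)"

text \<open>The second argument of a response function \<open>F\<close> is the list of the \<open>r\<close> coupled states.
  For joint smoothness, a point of the domain is encoded with coordinates indexed by pairs
  \<open>(k, a)\<close>: component \<open>a < d\<close> of the internal state if \<open>k = 0\<close>, and of the \<open>k\<close>-th coupled state
  if \<open>1 \<le> k \<le> r\<close>.\<close>

definition response_functions ::
  "nat \<Rightarrow> nat \<Rightarrow> ((nat \<Rightarrow> real) \<Rightarrow> (nat \<Rightarrow> real) list \<Rightarrow> nat \<Rightarrow> real) set" where
  "response_functions d r =
     {F. (\<forall>x\<in>phase_space d. \<forall>ys\<in>lists (phase_space d). length ys = r \<longrightarrow>
            F x ys \<in> phase_space d \<and>
            (\<forall>\<pi>. \<pi> permutes {..<r} \<longrightarrow> F x (permute_list \<pi> ys) = F x ys)) \<and>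
         (\<forall>b<d. C_infinity ({0..r} \<times> {..<d})
            (\<lambda>z. F (\<lambda>a. z (0, a)) (map (\<lambda>k a. z (k, a)) [1..<Suc r]) b))}"

definition sources :: "nat \<Rightarrow> network \<Rightarrow> nat \<Rightarrow> nat list" where
  "sources n E i = concat (map (\<lambda>u. replicate (E u i) u) [1..<Suc n])"

text \<open>Vector fields on \<open>P^n\<close> are extensional functions, hence equal iff they agree on \<open>P^n\<close>.
  The order in which \<^const>\<open>sources\<close> lists the inputs is irrelevant by symmetry.\<close>

definition admissible_fields ::
  "nat \<Rightarrow> nat \<Rightarrow> network \<Rightarrow> nat \<Rightarrow> ((nat \<Rightarrow> nat \<Rightarrow> real) \<Rightarrow> nat \<Rightarrow> nat \<Rightarrow> real) set" where
  "admissible_fields n r E d =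
     {\<lambda>x\<in>{1..n} \<rightarrow>\<^sub>E phase_space d. \<lambda>i\<in>{1..n}. F (x i) (map x (sources n E i)) | F.
        F \<in> response_functions d r}"

text \<open>Here \<open>r\<^sub>1\<close> and \<open>r\<^sub>2\<close> are the degrees of \<open>E\<^sub>1\<close> and \<open>E\<^sub>2\<close>.\<close>

definition ode_equivalent :: "nat \<Rightarrow> nat \<Rightarrow> network \<Rightarrow> nat \<Rightarrow> network \<Rightarrow> bool" where
  "ode_equivalent n r\<^sub>1 E\<^sub>1 r\<^sub>2 E\<^sub>2 \<longleftrightarrow>
     (\<exists>E\<^sub>2'\<in>networks n r\<^sub>2. network_iso n E\<^sub>2 E\<^sub>2' \<and>
        (\<forall>d\<ge>1. admissible_fields n r\<^sub>1 E\<^sub>1 d = admissible_fields n r\<^sub>2 E\<^sub>2' d))"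

definition minimal_network :: "nat \<Rightarrow> nat \<Rightarrow> network \<Rightarrow> bool" where
  "minimal_network n r E \<longleftrightarrow>
     (\<forall>s. \<forall>E'\<in>networks n s. ode_equivalent n r E s E' \<longrightarrow> num_edges n E \<le> num_edges n E')"

definition card_up_to_iso :: "nat \<Rightarrow> network set \<Rightarrow> nat" where
  "card_up_to_iso n S = card (S // {(E, E'). E \<in> S \<and> E' \<in> S \<and> network_iso n E E'})"

definition K :: "nat \<Rightarrow> nat \<Rightarrow> nat" where
  "K n r = card_up_to_iso n {E \<in> networks n r. connected_network n E}"

definition M :: "nat \<Rightarrow> nat \<Rightarrow> nat" where
  "M n r = card_up_to_iso n {E \<in> networks n r. connected_network n E \<and> minimal_network n r E}"

end

theory Submission
  imports Defs
begin

text \<open>Write a network as its adjacency matrix. For \<open>n \<ge> 2\<close>, a connected network \<open>E\<close> is written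
  uniquely as \<open>g B + m I\<close>, where \<open>m\<close> is the least number of loops at a vertex, \<open>g\<close> is the greatest
  common divisor of the entries of \<open>E - m I\<close>, and \<open>B\<close> is \<^emph>\<open>reduced\<close>: some vertex has no loop and the
  entries have greatest common divisor \<open>1\<close> (\<open>reduced_decomposition\<close>, \<open>network_iso_inflate_iff\<close>).
  The numbers \<open>m\<close> and \<open>g\<close> and the isomorphism class of \<open>B\<close> depend only on the isomorphism class
  of \<open>E\<close>. If \<open>B\<close> has degree \<open>s\<close> and \<open>E\<close> has degree \<open>r\<close>, then \<open>r = g s + m\<close>, so that for given
  \<open>r\<close> and \<open>s\<close> the possible values of \<open>g\<close> are \<open>1, \<dots>, r div s\<close>, and \<open>g\<close> determines \<open>m\<close>.
  Once the minimal networks are known to be the reduced ones, counting gives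
  \<open>K n r = (\<Sum>s=1..r. (r div s) * M n s)\<close>, which is the claim with the term \<open>s = r\<close> isolated.

  A minimal network is reduced because \<open>g B + m I\<close> and \<open>B\<close> have the same admissible vector fields
  (\<open>admissible_fields_inflate\<close>). One inclusion repeats arguments of the response function. For the
  other, a symmetric \<open>F\<close> of \<open>s\<close> coupled states has to be extended to \<open>g s + m\<close> coupled states.
  The extension is explicit, as the value of \<open>F\<close> at the coupled states
  \<open>y\<^sub>1, \<dots>, y\<^sub>s\<close> can be recovered from the point measure \<open>\<nu> = \<delta>\<^bsub>y\<^sub>1\<^esub> + \<dots> + \<delta>\<^bsub>y\<^sub>s\<^esub>\<close> by
  \<open>s! F(x; y\<^sub>1, \<dots>, y\<^sub>s) = \<integral> F(x; u\<^sub>1, \<dots>, u\<^sub>s) \<nu>(du\<^sub>1) (\<nu> - \<delta>\<^bsub>u\<^sub>1\<^esub>)(du\<^sub>2) \<dots> (\<nu> - \<delta>\<^bsub>u\<^sub>1\<^esub> - \<dots>)(du\<^sub>s)\<close>,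
  and if the inputs \<open>z\<close> of the inflated network consist of \<open>g\<close> copies of each \<open>y\<^sub>j\<close> and \<open>m\<close> copies
  of \<open>x\<close>, then \<open>\<nu> = (\<Sum> \<delta>\<^sub>z - m \<delta>\<^sub>x) / g\<close>. Substituting this signed measure for arbitrary inputs
  defines a symmetric extension which is a finite linear combination of values of \<open>F\<close> at
  lists of inputs, hence smooth.

  A reduced network \<open>B\<close> is minimal because equality of the admissible vector fields already
  for \<open>P = \<real>\<close> forces a relation \<open>B = \<alpha> I + \<beta> E\<close> with real coefficients: realize the linear
  field with matrix \<open>B\<close> by a response function of \<open>E\<close> and differentiate at the origin
  (\<open>admissible_fields_subset_imp_linear\<close>). Reducedness then makes \<open>1 / \<beta>\<close> a positive integer and
  \<open>-\<alpha> / \<beta>\<close> a natural number, so that the degree of \<open>E\<close> is at least that of \<open>B\<close>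
  (\<open>reduced_degree_le\<close>).

  With a single cell, all fields are of the form \<open>x \<mapsto> F x\<close>, so every network is
  equivalent to the edgeless one.\<close>

section \<open>Smooth functions and coordinate substitutions\<close>

text \<open>The chain rule for moving several coordinates at once. Only partial derivatives are at hand,
  on a function space without a norm; adding one coordinate at a time reduces the statement to a
  function of two real variables, where continuity of one of the partial derivatives suffices.\<close>

lemma has_real_derivative_simultaneous:
  fixes f :: "('i \<Rightarrow> real) \<Rightarrow> real"
  assumes "finite S" "S \<subseteq> I"
    and cont: "\<And>i. i \<in> I \<Longrightarrow> continuous_on (coord_space I) (g i)"
    and deriv: "\<And>i x. i \<in> I \<Longrightarrow> x \<in> coord_space I \<Longrightarrow>
      ((\<lambda>t. f (x(i := t))) has_real_derivative g i x) (at (x i))"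
    and "x \<in> coord_space I"
  shows "((\<lambda>t. f (\<lambda>i. if i \<in> S then t else x i)) has_real_derivative
    (\<Sum>i\<in>S. g i (\<lambda>i. if i \<in> S then t else x i))) (at t)"
  using assms(1,2,5)
proof (induction S arbitrary: x t rule: finite_induct)
  case empty
  then show ?case by simp
next
  case (insert j S)
  define y where "y = (\<lambda>s u i. if i = j then u else if i \<in> S then s else x i)"
  have y: "y s u \<in> coord_space I" for s u
    using insert.prems by (auto simp: y_def coord_space_def)
  have y_cont: "continuous_on UNIV (\<lambda>p. y (fst p) (snd p))"
    unfolding y_def
    apply (rule continuous_on_coordinatewise_then_product)
    subgoal for i by (cases "i = j"; cases "i \<in> S") (auto intro!: continuous_intros)
    done
  have g_cont: "continuous_on UNIV (\<lambda>p. g j (y (fst p) (snd p)))"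
    by (rule continuous_on_compose2[OF cont y_cont]) (use insert.prems y in auto)
  have partial_1: "((\<lambda>s. f (y s t)) has_real_derivative (\<Sum>i\<in>S. g i (y t t))) (at t)"
  proof -
    have eq: "(\<lambda>i. if i \<in> S then s else (x(j := t)) i) = y s t" for s
      using insert.hyps by (auto simp: y_def)
    show ?thesis
      using insert.IH[of "x(j := t)" t] insert.prems unfolding eq
      by (auto simp: coord_space_def)
  qed
  have partial_2: "((\<lambda>u. f (y s u)) has_real_derivative g j (y s u)) (at u)" for s u
  proof -
    have "(y s u)(j := u') = y s u'" for u' by (auto simp: y_def)
    then show ?thesis using deriv[OF _ y, of j s u] insert.prems by (simp add: y_def)
  qed
  have "((\<lambda>(s, u). f (y s u)) has_derivative
      (\<lambda>(ds, du). (\<Sum>i\<in>S. g i (y t t)) * ds + blinfun_scaleR_left (g j (y t t)) du))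
      (at (t, t) within UNIV \<times> UNIV)"
  proof (rule has_derivative_partialsI[where fy = "\<lambda>s u. blinfun_scaleR_left (g j (y s u))"])
    show "((\<lambda>s. f (y s t)) has_derivative (*) (\<Sum>i\<in>S. g i (y t t))) (at t)"
      using partial_1 by (simp add: has_field_derivative_def)
    show "((\<lambda>u. f (y s u)) has_derivative blinfun_scaleR_left (g j (y s u))) (at u within UNIV)"
      for s u
    proof -
      have "(*) (g j (y s u)) = blinfun_scaleR_left (g j (y s u))" by (simp add: fun_eq_iff)
      then show ?thesis using partial_2[of s u] by (simp add: has_field_derivative_def)
    qed
    have "continuous_on UNIV (\<lambda>(s, u). blinfun_scaleR_left (g j (y s u)))"
      unfolding split_beta by (intro continuous_intros g_cont)
    then show "continuous (at (t, t) within UNIV \<times> UNIV) (\<lambda>(s, u). blinfun_scaleR_left (g j (y s u)))"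
      by (simp add: continuous_on_eq_continuous_within)
  qed auto
  then have "((\<lambda>p. f (y (fst p) (snd p))) has_derivative
      (\<lambda>(ds, du). (\<Sum>i\<in>S. g i (y t t)) * ds + g j (y t t) * du)) (at (t, t))"
    by (simp add: case_prod_unfold mult.commute[of "g j _"])
  then have "((\<lambda>s. f (y s s)) has_derivative
      (\<lambda>s. ((\<Sum>i\<in>S. g i (y t t)) + g j (y t t)) * s)) (at t)"
    using diff_chain_at[of "\<lambda>s. (s, s)" "\<lambda>s. (s, s)" t "\<lambda>p. f (y (fst p) (snd p))"
        "\<lambda>(ds, du). (\<Sum>i\<in>S. g i (y t t)) * ds + g j (y t t) * du"]
    by (simp add: o_def has_derivative_Pair distrib_right)
  moreover have "(\<lambda>i. if i \<in> insert j S then s else x i) = y s s" for s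
    by (auto simp: y_def)
  ultimately show ?case
    using insert.hyps
    by (simp add: has_field_derivative_def add.commute)
qed

lemma continuous_on_coordinate: "continuous_on A (\<lambda>x::'i \<Rightarrow> real. x i)"
  by (rule continuous_on_subset[OF continuous_on_product_coordinates]) simp

lemma C_diff_imp_continuous: "C_diff k I f \<Longrightarrow> continuous_on (coord_space I) f"
  by (cases k) auto

lemma C_diff_cong:
  assumes "\<And>x. x \<in> coord_space I \<Longrightarrow> f x = g x"
  shows "C_diff k I f \<longleftrightarrow> C_diff k I g"
proof (cases k)
  case 0
  then show ?thesis using assms by (simp cong: continuous_on_cong)
next
  case (Suc k')
  have "(\<lambda>t. f (x(i := t))) = (\<lambda>t. g (x(i := t)))" if "x \<in> coord_space I" "i \<in> I" for x i
    using that assms by (auto simp: coord_space_def fun_eq_iff)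
  with Suc show ?thesis using assms by (simp cong: continuous_on_cong)
qed

lemma C_diff_const: "C_diff k I (\<lambda>x. c)"
  by (induction k arbitrary: c) (auto intro!: exI[of _ "\<lambda>_. 0"])

lemma C_diff_coordinate: "C_diff k I (\<lambda>x. x i)"
proof (cases k)
  case (Suc k')
  show ?thesis
    unfolding Suc C_diff.simps
  proof (intro conjI ballI)
    fix j assume "j \<in> I"
    show "\<exists>g. C_diff k' I g \<and> (\<forall>x\<in>coord_space I.
        ((\<lambda>t. (x(j := t)) i) has_real_derivative g x) (at (x j)))"
      by (intro exI[of _ "\<lambda>_. if i = j then 1 else 0"]) (auto intro: C_diff_const)
  qed (rule continuous_on_coordinate)
qed (simp add: continuous_on_coordinate)

lemma C_diff_add: "C_diff k I f \<Longrightarrow> C_diff k I g \<Longrightarrow> C_diff k I (\<lambda>x. f x + g x)"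
proof (induction k arbitrary: f g)
  case (Suc k)
  show ?case
    unfolding C_diff.simps
  proof (intro conjI ballI)
    fix i assume "i \<in> I"
    with Suc.prems obtain f' g' where f': "C_diff k I f'" and g': "C_diff k I g'"
      and df: "\<forall>x\<in>coord_space I. ((\<lambda>t. f (x(i := t))) has_real_derivative f' x) (at (x i))"
      and dg: "\<forall>x\<in>coord_space I. ((\<lambda>t. g (x(i := t))) has_real_derivative g' x) (at (x i))"
      unfolding C_diff.simps by metis
    show "\<exists>h. C_diff k I h \<and> (\<forall>x\<in>coord_space I.
        ((\<lambda>t. f (x(i := t)) + g (x(i := t))) has_real_derivative h x) (at (x i)))"
      using Suc.IH[OF f' g'] df dg
      by (intro exI[of _ "\<lambda>x. f' x + g' x"]) (auto intro: DERIV_add)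
  qed (use Suc.prems in \<open>auto intro: continuous_intros\<close>)
qed (auto intro: continuous_intros)

lemma C_diff_cmult: "C_diff k I f \<Longrightarrow> C_diff k I (\<lambda>x. c * f x)"
proof (induction k arbitrary: f)
  case (Suc k)
  show ?case
    unfolding C_diff.simps
  proof (intro conjI ballI)
    fix i assume "i \<in> I"
    with Suc.prems obtain f' where f': "C_diff k I f'"
      and df: "\<forall>x\<in>coord_space I. ((\<lambda>t. f (x(i := t))) has_real_derivative f' x) (at (x i))"
      unfolding C_diff.simps by metis
    show "\<exists>h. C_diff k I h \<and> (\<forall>x\<in>coord_space I.
        ((\<lambda>t. c * f (x(i := t))) has_real_derivative h x) (at (x i)))"
      using Suc.IH[OF f'] df
      by (intro exI[of _ "\<lambda>x. c * f' x"]) (auto intro: DERIV_cmult)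
  qed (use Suc.prems in \<open>auto intro: continuous_intros\<close>)
qed (auto intro: continuous_intros)

lemma C_diff_sum:
  assumes "\<And>a. a \<in> A \<Longrightarrow> C_diff k I (f a)"
  shows "C_diff k I (\<lambda>x. \<Sum>a\<in>A. f a x)"
  using assms
  by (induction A rule: infinite_finite_induct) (auto intro: C_diff_const C_diff_add)

lemma C_diff_sum_list:
  assumes "\<And>a. a \<in> set as \<Longrightarrow> C_diff k I (f a)"
  shows "C_diff k I (\<lambda>x. \<Sum>a\<leftarrow>as. f a x)"
  using assms by (induction as) (auto intro: C_diff_const C_diff_add)

text \<open>Pulling back along a substitution of coordinates (with repetitions allowed) keeps a function
  smooth: the partial derivative in direction \<open>j\<close> is the sum of the pulled back partial
  derivatives over all coordinates that \<open>\<sigma>\<close> sends to \<open>j\<close>.\<close>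

lemma C_diff_substitution:
  assumes "finite I" "\<sigma> ` I \<subseteq> J" "C_diff k I f"
  shows "C_diff k J (\<lambda>z. f (\<lambda>i. if i \<in> I then z (\<sigma> i) else 0))"
  using assms(3)
proof (induction k arbitrary: f)
  have sub_cont: "continuous_on A (\<lambda>z i. if i \<in> I then z (\<sigma> i) else (0::real))" for A
    apply (rule continuous_on_coordinatewise_then_product)
    subgoal for i by (cases "i \<in> I") (auto intro: continuous_on_coordinate)
    done
  have sub: "(\<lambda>i. if i \<in> I then z (\<sigma> i) else (0::real)) \<in> coord_space I" for z
    by (simp add: coord_space_def)
  have comp_cont: "continuous_on (coord_space J) (\<lambda>z. f (\<lambda>i. if i \<in> I then z (\<sigma> i) else 0))"
    if "continuous_on (coord_space I) f" for f
    by (rule continuous_on_compose2[OF that sub_cont]) (use sub in auto)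
  {
    case 0
    then show ?case using comp_cont by simp
  next
    case (Suc k)
    from Suc.prems have "\<exists>g. \<forall>i\<in>I. C_diff k I (g i) \<and>
        (\<forall>x\<in>coord_space I. ((\<lambda>t. f (x(i := t))) has_real_derivative g i x) (at (x i)))"
      unfolding C_diff.simps by metis
    then obtain g where g: "\<And>i. i \<in> I \<Longrightarrow> C_diff k I (g i)"
      and df: "\<And>i x. i \<in> I \<Longrightarrow> x \<in> coord_space I \<Longrightarrow>
        ((\<lambda>t. f (x(i := t))) has_real_derivative g i x) (at (x i))"
      by blast
    show ?case
      unfolding C_diff.simps
    proof (intro conjI ballI)
      show "continuous_on (coord_space J) (\<lambda>z. f (\<lambda>i. if i \<in> I then z (\<sigma> i) else 0))"
        by (rule comp_cont[OF C_diff_imp_continuous[OF Suc.prems]])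
      fix j assume "j \<in> J"
      define S where "S = {i \<in> I. \<sigma> i = j}"
      show "\<exists>h. C_diff k J h \<and> (\<forall>z\<in>coord_space J.
          ((\<lambda>t. f (\<lambda>i. if i \<in> I then (z(j := t)) (\<sigma> i) else 0)) has_real_derivative h z) (at (z j)))"
      proof (intro exI conjI ballI)
        show "C_diff k J (\<lambda>z. \<Sum>i\<in>S. g i (\<lambda>i. if i \<in> I then z (\<sigma> i) else 0))"
          by (intro C_diff_sum Suc.IH g) (simp add: S_def)
        fix z :: "'b \<Rightarrow> real" assume "z \<in> coord_space J"
        let ?x = "\<lambda>i. if i \<in> I then z (\<sigma> i) else 0"
        have eq: "(\<lambda>i. if i \<in> S then t else ?x i) =
            (\<lambda>i. if i \<in> I then (z(j := t)) (\<sigma> i) else 0)" for t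
          by (auto simp: S_def)
        have "((\<lambda>t. f (\<lambda>i. if i \<in> S then t else ?x i)) has_real_derivative
            (\<Sum>i\<in>S. g i (\<lambda>i. if i \<in> S then z j else ?x i))) (at (z j))"
        proof (rule has_real_derivative_simultaneous[where I = I])
          show "finite S" "S \<subseteq> I" using assms(1) by (auto simp: S_def)
        qed (fact C_diff_imp_continuous[OF g] df sub)+
        then show "((\<lambda>t. f (\<lambda>i. if i \<in> I then (z(j := t)) (\<sigma> i) else 0)) has_real_derivative
            (\<Sum>i\<in>S. g i ?x)) (at (z j))"
          unfolding eq by (simp only: fun_upd_triv)
      qed
    qed
  }
qed

section \<open>Response functions\<close>

text \<open>A point \<open>z\<close> of the domain of a response function has coordinates \<open>(k, a)\<close>; its \<open>k\<close>-th row is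
  the internal state for \<open>k = 0\<close> and a coupled state for \<open>k \<ge> 1\<close>.\<close>

definition state :: "(nat \<times> nat \<Rightarrow> real) \<Rightarrow> nat \<Rightarrow> nat \<Rightarrow> real" where
  "state z k = (\<lambda>a. z (k, a))"

lemma response_function_closed:
  assumes "F \<in> response_functions d r" "x \<in> phase_space d" "set ys \<subseteq> phase_space d" "length ys = r"
  shows "F x ys \<in> phase_space d"
  using assms by (auto simp: response_functions_def lists_eq_set)

lemma response_function_symmetric:
  assumes "F \<in> response_functions d r" "x \<in> phase_space d" "set ys \<subseteq> phase_space d" "length ys = r"
    and "mset ys' = mset ys"
  shows "F x ys' = F x ys"
proof -
  obtain \<pi> where "\<pi> permutes {..<length ys}" "permute_list \<pi> ys = ys'"
    using mset_eq_permutation[OF assms(5)] by blast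
  with assms(1-4) show ?thesis by (auto simp: response_functions_def lists_eq_set)
qed

lemma response_function_smooth:
  assumes "F \<in> response_functions d r" "b < d"
  shows "C_infinity ({0..r} \<times> {..<d}) (\<lambda>z. F (state z 0) (map (state z) [1..<Suc r]) b)"
  using assms by (simp add: response_functions_def state_def[abs_def] del: upt_Suc)

lemma response_functionsI:
  assumes "\<And>x ys. x \<in> phase_space d \<Longrightarrow> set ys \<subseteq> phase_space d \<Longrightarrow> length ys = r \<Longrightarrow>
      F x ys \<in> phase_space d"
    and "\<And>x ys ys'. mset ys' = mset ys \<Longrightarrow> x \<in> phase_space d \<Longrightarrow> set ys \<subseteq> phase_space d \<Longrightarrow>
      length ys = r \<Longrightarrow> F x ys' = F x ys"
    and "\<And>b. b < d \<Longrightarrow>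
      C_infinity ({0..r} \<times> {..<d}) (\<lambda>z. F (state z 0) (map (state z) [1..<Suc r]) b)"
  shows "F \<in> response_functions d r"
  unfolding response_functions_def
proof (intro CollectI conjI ballI impI allI)
  fix x ys \<pi>
  assume "x \<in> phase_space d" "ys \<in> lists (phase_space d)" "length ys = r" "\<pi> permutes {..<r}"
  then show "F x (permute_list \<pi> ys) = F x ys"
    by (intro assms(2)) (auto simp: lists_eq_set)
qed (use assms(1,3) in \<open>auto simp: lists_eq_set state_def[abs_def] simp del: upt_Suc\<close>)

text \<open>All functions built below from a response function plug some of the states of \<open>z\<close>, possibly
  repeatedly and possibly including the internal one, into its coupled arguments.\<close>

lemma response_function_substitution_smooth:
  assumes F: "F \<in> response_functions d r" and "b < d"
    and js: "length js = r" "set js \<subseteq> {0..r'}"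
  shows "C_infinity ({0..r'} \<times> {..<d}) (\<lambda>z. F (state z 0) (map (state z) js) b)"
  unfolding C_infinity_def
proof
  fix k
  define I J where "I = {0..r} \<times> {..<d}" and "J = {0..r'} \<times> {..<d}"
  define \<sigma> where "\<sigma> = (\<lambda>(k, a::nat). ((0 # js) ! k, a))"
  define f where "f = (\<lambda>z. F (state z 0) (map (state z) [1..<Suc r]) b)"
  let ?sub = "\<lambda>z i. if i \<in> I then z (\<sigma> i) else (0::real)"
  have in_J: "(0 # js) ! k \<le> r'" if "k \<le> r" for k
    using that js nth_mem[of "k - 1" js] by (cases k) (auto simp: subset_iff)
  have sub_state: "state (?sub z) k = state z ((0 # js) ! k)" if "z \<in> coord_space J" "k \<le> r" for z k
    using that by (auto simp: state_def I_def J_def \<sigma>_def coord_space_def)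
  have "C_diff k J (\<lambda>z. f (?sub z))"
  proof (rule C_diff_substitution)
    show "\<sigma> ` I \<subseteq> J" using in_J by (auto simp: I_def J_def \<sigma>_def)
    show "C_diff k I f"
      using response_function_smooth[OF F \<open>b < d\<close>] by (simp add: f_def I_def C_infinity_def)
  qed (simp add: I_def)
  moreover have "f (?sub z) = F (state z 0) (map (state z) js) b" if z: "z \<in> coord_space J" for z
  proof -
    have "map (state (?sub z)) [1..<Suc r] = map (state z) js"
      by (rule nth_equalityI) (use sub_state[OF z] js in \<open>auto simp del: upt_Suc\<close>)
    then show ?thesis using sub_state[OF z, of 0] by (simp add: f_def del: upt_Suc)
  qed
  ultimately show "C_diff k ({0..r'} \<times> {..<d}) (\<lambda>z. F (state z 0) (map (state z) js) b)"
    unfolding J_def[symmetric] by (rule C_diff_cong[THEN iffD1, rotated])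
qed

section \<open>Integration against a factorial measure\<close>

text \<open>A list of weighted points stands for the signed measure \<open>\<nu> = \<Sum> c \<delta>\<^sub>p\<close>. With \<open>us = [u\<^sub>1, \<dots>, u\<^sub>j]\<close>
  already chosen, the remaining \<open>k\<close> arguments of \<open>h\<close> are integrated one after the other,
  the next one against \<open>\<nu> - \<delta>\<^bsub>u\<^sub>1\<^esub> - \<dots> - \<delta>\<^bsub>u\<^sub>j\<^esub>\<close>. For \<open>us = []\<close> this is the integral of \<open>h\<close>
  against the \<open>k\<close>-th factorial measure of \<open>\<nu>\<close>.\<close>

primrec factorial_integral ::
  "(real \<times> 'p) list \<Rightarrow> nat \<Rightarrow> ('p list \<Rightarrow> real) \<Rightarrow> 'p list \<Rightarrow> real" where
  "factorial_integral \<nu> 0 h us = h us"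
| "factorial_integral \<nu> (Suc k) h us =
     (\<Sum>(c, p)\<leftarrow>\<nu>. c * factorial_integral \<nu> k h (us @ [p])) -
     (\<Sum>u\<leftarrow>us. factorial_integral \<nu> k h (us @ [u]))"

lemma sum_list_cong_mset:
  fixes f :: "'a \<Rightarrow> 'b::comm_monoid_add"
  assumes "mset xs = mset ys"
  shows "(\<Sum>x\<leftarrow>xs. f x) = (\<Sum>x\<leftarrow>ys. f x)"
proof -
  have "(\<Sum>x\<in>#mset xs. f x) = (\<Sum>x\<in>#mset ys. f x)" using assms by simp
  then show ?thesis by (simp only: sum_mset_sum_list flip: mset_map)
qed

lemma factorial_integral_cong_mset:
  assumes "mset \<nu> = mset \<nu>'"
  shows "factorial_integral \<nu> k h us = factorial_integral \<nu>' k h us"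
proof (induction k arbitrary: us)
  case (Suc k)
  have "(\<Sum>p\<leftarrow>\<nu>. f p) = (\<Sum>p\<leftarrow>\<nu>'. f p)" for f :: "real \<times> 'a \<Rightarrow> real"
    by (rule sum_list_cong_mset[OF assms])
  then show ?case unfolding factorial_integral.simps Suc.IH by (simp only:)
qed simp

text \<open>If \<open>\<nu>\<close> acts on functions as \<open>\<Sum> \<delta>\<^bsub>y j\<^esub>\<close>, then subtracting the points already drawn leaves
  the point masses at the other indices. The integral therefore runs over injective choices of
  indices, and symmetry makes all of them contribute the same value. The hypothesis constrains
  only the action of \<open>\<nu>\<close> on functions, because the lists to which this applies contain masses that
  cancel each other.\<close>

lemma factorial_integral_of_point_masses:
  fixes \<nu> :: "(real \<times> 'p) list"
  assumes \<nu>: "\<And>\<phi>. (\<Sum>(c, p)\<leftarrow>\<nu>. c * \<phi> p) = (\<Sum>j<s. \<phi> (y j))"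
    and sym: "\<And>l. mset l = mset (map y [0..<s]) \<Longrightarrow> h l = h (map y [0..<s])"
    and "distinct L" "set L \<subseteq> {..<s}" "length L + k = s"
  shows "factorial_integral \<nu> k h (map y L) = fact k * h (map y [0..<s])"
  using assms(3-)
proof (induction k arbitrary: L)
  case 0
  then have "set L = {..<s}" by (simp add: card_subset_eq distinct_card)
  then have "mset L = mset [0..<s]"
    using 0 by (metis atLeast_upt distinct_upt set_eq_iff_mset_eq_distinct)
  then have "mset (map y L) = mset (map y [0..<s])" by simp
  then have "h (map y L) = h (map y [0..<s])" by (rule sym)
  then show ?case by simp
next
  case (Suc k)
  let ?\<Phi> = "\<lambda>j. factorial_integral \<nu> k h (map y (L @ [j]))"
  have "factorial_integral \<nu> (Suc k) h (map y L) = (\<Sum>j<s. ?\<Phi> j) - (\<Sum>j\<in>set L. ?\<Phi> j)"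
    using \<nu>[of "\<lambda>p. factorial_integral \<nu> k h (map y L @ [p])"] Suc.prems(1)
    by (simp add: sum_list_distinct_conv_sum_set comp_def)
  also have "\<dots> = (\<Sum>j\<in>{..<s} - set L. ?\<Phi> j)"
    using Suc.prems by (simp add: sum_diff)
  also have "\<dots> = (\<Sum>j\<in>{..<s} - set L. fact k * h (map y [0..<s]))"
    using Suc.prems by (intro sum.cong refl Suc.IH) auto
  also have "card ({..<s} - set L) = Suc k"
    using Suc.prems by (simp add: card_Diff_subset distinct_card)
  then have "(\<Sum>j\<in>{..<s} - set L. fact k * h (map y [0..<s])) = fact (Suc k) * h (map y [0..<s])"
    by simp
  finally show ?case .
qed

text \<open>With the points of \<open>\<nu>\<close> taken from the rows of \<open>z\<close>, the integral unfolds to a linear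
  combination of substitutions into \<open>F\<close>.\<close>

lemma factorial_integral_smooth:
  assumes F: "F \<in> response_functions d s" and "b < d"
    and "set js \<subseteq> {0..r}" "length js + k = s"
  shows "C_infinity ({0..r} \<times> {..<d}) (\<lambda>z. factorial_integral
    (map (\<lambda>j. (w j, state z j)) [0..<Suc r]) k (\<lambda>us. F (state z 0) us b) (map (state z) js))"
  using assms(3,4)
proof (induction k arbitrary: js)
  case 0
  then show ?case using response_function_substitution_smooth[OF F \<open>b < d\<close>] by simp
next
  case (Suc k)
  define G where "G = (\<lambda>js z. factorial_integral (map (\<lambda>j. (w j, state z j)) [0..<Suc r]) k
    (\<lambda>us. F (state z 0) us b) (map (state z) js))"
  have G: "C_diff m ({0..r} \<times> {..<d}) (G (js @ [j]))" if "j \<le> r" for j m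
    using Suc.IH[of "js @ [j]"] Suc.prems that by (auto simp: G_def C_infinity_def)
  have "C_diff m ({0..r} \<times> {..<d}) (\<lambda>z. (\<Sum>j\<leftarrow>[0..<Suc r]. w j * G (js @ [j]) z) +
      (-1) * (\<Sum>j\<leftarrow>js. G (js @ [j]) z))" for m
    using Suc.prems by (intro C_diff_add C_diff_cmult C_diff_sum_list G) auto
  then show ?case
    by (simp add: C_infinity_def G_def comp_def del: upt_Suc)
qed

section \<open>Inflating a network\<close>

lemma image_mset_repeat_mset: "image_mset f (repeat_mset k A) = repeat_mset k (image_mset f A)"
  by (induction k) auto

lemma mset_concat_replicate: "mset (concat (map (replicate g) ys)) = repeat_mset g (mset ys)"
  by (induction ys) auto

text \<open>The inclusion of the fields of an inflated network in those of the original one: each input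
  is read \<open>g\<close> times, and the \<open>m\<close> additional loops read the internal state.\<close>

lemma response_function_repeat:
  assumes F: "F \<in> response_functions d (g * s + m)"
  shows "(\<lambda>x ys. F x (concat (map (replicate g) ys) @ replicate m x)) \<in> response_functions d s"
proof (rule response_functionsI)
  have set: "set (concat (map (replicate g) ys) @ replicate m x) \<subseteq> A" if "x \<in> A" "set ys \<subseteq> A"
    for x :: "nat \<Rightarrow> real" and ys A
    using that by (auto split: if_splits)
  have len: "length (concat (map (replicate g) ys) @ replicate m x) = g * s + m" if "length ys = s"
    for x :: 'a and ys
    using that by (simp add: length_concat comp_def sum_list_triv)
  show "F x (concat (map (replicate g) ys) @ replicate m x) \<in> phase_space d"
    if "x \<in> phase_space d" "set ys \<subseteq> phase_space d" "length ys = s" for x ys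
    using response_function_closed[OF F that(1) set[OF that(1,2)] len[OF that(3)]] .
  show "F x (concat (map (replicate g) ys') @ replicate m x) =
      F x (concat (map (replicate g) ys) @ replicate m x)"
    if "mset ys' = mset ys" "x \<in> phase_space d" "set ys \<subseteq> phase_space d" "length ys = s" for x ys ys'
  proof (rule response_function_symmetric[OF F that(2) set[OF that(2,3)] len[OF that(4)]])
    show "mset (concat (map (replicate g) ys') @ replicate m x) =
        mset (concat (map (replicate g) ys) @ replicate m x)"
      using that(1) by (simp add: mset_concat_replicate)
  qed
  fix b assume "b < d"
  have "length (concat (map (replicate g) [1..<Suc s]) @ replicate m 0) = g * s + m"
    by (simp add: length_concat comp_def sum_list_triv del: upt_Suc)
  moreover have "set (concat (map (replicate g) [1..<Suc s]) @ replicate m 0) \<subseteq> {0..s}"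
    by (auto split: if_splits simp del: upt_Suc)
  ultimately have "C_infinity ({0..s} \<times> {..<d}) (\<lambda>z. F (state z 0)
      (map (state z) (concat (map (replicate g) [1..<Suc s]) @ replicate m 0)) b)"
    by (rule response_function_substitution_smooth[OF F \<open>b < d\<close>])
  then show "C_infinity ({0..s} \<times> {..<d}) (\<lambda>z. F (state z 0)
      (concat (map (replicate g) (map (state z) [1..<Suc s])) @ replicate m (state z 0)) b)"
    by (simp add: map_concat comp_def map_replicate del: upt_Suc)
qed

text \<open>The converse inclusion. The extension integrates \<open>F\<close> against the factorial measure of
  \<open>(\<Sum> \<delta>\<^sub>z - m \<delta>\<^sub>x) / g\<close>, the sum running over all \<open>g s + m\<close> inputs. On the inputs of an inflated
  network this measure is the sum of the \<open>s\<close> original point masses.\<close>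

lemma response_function_extension:
  assumes F: "F \<in> response_functions d s" and "g > 0"
  obtains F' where "F' \<in> response_functions d (g * s + m)"
    and "\<And>x ys zs. x \<in> phase_space d \<Longrightarrow> set ys \<subseteq> phase_space d \<Longrightarrow> length ys = s \<Longrightarrow>
      mset zs = repeat_mset g (mset ys) + replicate_mset m x \<Longrightarrow> F' x zs = F x ys"
proof
  define \<nu> :: "(nat \<Rightarrow> real) \<Rightarrow> (nat \<Rightarrow> real) list \<Rightarrow> (real \<times> (nat \<Rightarrow> real)) list" where
    "\<nu> x zs = (- real m / real g, x) # map (Pair (1 / real g)) zs" for x zs
  define F' where "F' = (\<lambda>x zs b. if b < d then
    factorial_integral (\<nu> x zs) s (\<lambda>us. F x us b) [] / fact s else 0)"
  show "F' \<in> response_functions d (g * s + m)"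
  proof (rule response_functionsI)
    show "F' x zs \<in> phase_space d" for x zs by (simp add: F'_def coord_space_def)
    show "F' x zs' = F' x zs" if "mset zs' = mset zs" for x zs zs'
    proof -
      have "mset (\<nu> x zs') = mset (\<nu> x zs)" using that by (simp add: \<nu>_def)
      then show ?thesis by (simp only: F'_def factorial_integral_cong_mset[of "\<nu> x zs'" "\<nu> x zs"])
    qed
    fix b assume "b < d"
    let ?r = "g * s + m"
    define w where "w j = (if j = 0 then - real m / real g else 1 / real g)" for j :: nat
    have "\<nu> (state z 0) (map (state z) [1..<Suc ?r]) = map (\<lambda>j. (w j, state z j)) [0..<Suc ?r]" for z
      by (simp add: \<nu>_def w_def upt_conv_Cons[of 0 "Suc ?r"] del: upt_Suc)
    then have eq: "F' (state z 0) (map (state z) [1..<Suc ?r]) b = 1 / fact s *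
        factorial_integral (map (\<lambda>j. (w j, state z j)) [0..<Suc ?r]) s (\<lambda>us. F (state z 0) us b)
          (map (state z) [])" for z
      using \<open>b < d\<close> by (simp add: F'_def del: upt_Suc)
    have "C_infinity ({0..?r} \<times> {..<d}) (\<lambda>z. factorial_integral
        (map (\<lambda>j. (w j, state z j)) [0..<Suc ?r]) s (\<lambda>us. F (state z 0) us b) (map (state z) []))"
      by (rule factorial_integral_smooth[OF F \<open>b < d\<close>]) auto
    then show "C_infinity ({0..?r} \<times> {..<d}) (\<lambda>z. F' (state z 0) (map (state z) [1..<Suc ?r]) b)"
      unfolding eq C_infinity_def by (intro allI C_diff_cmult) (erule spec)
  qed
  fix x ys zs
  assume x: "x \<in> phase_space d" and ys: "set ys \<subseteq> phase_space d" "length ys = s"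
    and zs: "mset zs = repeat_mset g (mset ys) + replicate_mset m x"
  have \<nu>: "(\<Sum>(c, p)\<leftarrow>\<nu> x zs. c * \<phi> p) = (\<Sum>j<s. \<phi> (ys ! j))" for \<phi>
  proof -
    have "(\<Sum>p\<in>#repeat_mset k A. \<phi> p) = real k * (\<Sum>p\<in>#A. \<phi> p)" for k A
      by (induction k) (auto simp: algebra_simps)
    then have "(\<Sum>p\<leftarrow>zs. \<phi> p) = real g * (\<Sum>p\<leftarrow>ys. \<phi> p) + real m * \<phi> x"
      by (simp add: zs flip: sum_mset_sum_list)
    moreover have "(\<Sum>p\<leftarrow>ys. \<phi> p) = (\<Sum>j<s. \<phi> (ys ! j))"
      using ys(2) by (simp add: sum_list_sum_nth atLeast0LessThan)
    ultimately show ?thesis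
      using \<open>g > 0\<close> sum_list_const_mult[of "1 / real g" \<phi> zs]
      by (simp add: \<nu>_def comp_def add_divide_distrib)
  qed
  show "F' x zs = F x ys"
  proof
    fix b
    show "F' x zs b = F x ys b"
    proof (cases "b < d")
      case True
      have ys_eq: "map ((!) ys) [0..<s] = ys" using map_nth[of ys] ys(2) by simp
      have "factorial_integral (\<nu> x zs) s (\<lambda>us. F x us b) (map ((!) ys) []) =
          fact s * F x (map ((!) ys) [0..<s]) b"
      proof (rule factorial_integral_of_point_masses[OF \<nu>])
        fix l assume "mset l = mset (map ((!) ys) [0..<s])"
        then show "F x l b = F x (map ((!) ys) [0..<s]) b"
          unfolding ys_eq using response_function_symmetric[OF F x ys, of l] by simp
      qed auto
      then show ?thesis using True unfolding ys_eq by (simp add: F'_def)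
    next
      case False
      then show ?thesis
        using response_function_closed[OF F x ys] by (simp add: F'_def coord_space_def)
    qed
  qed
qed

text \<open>The matrix \<open>g B + m I\<close>; loops are added on the vertex set only, because multiplicities vanish
  outside.\<close>

definition inflate :: "nat \<Rightarrow> nat \<Rightarrow> nat \<Rightarrow> network \<Rightarrow> network" where
  "inflate n g m B = (\<lambda>u v. g * B u v + (if u = v \<and> u \<in> {1..n} then m else 0))"

lemma count_sources:
  "count (mset (sources n E i)) u = (if u \<in> {1..n} then E u i else 0)"
proof -
  have "mset (sources n E i) = (\<Sum>u\<in>{1..n}. replicate_mset (E u i) u)"
    by (simp add: sources_def mset_concat comp_def interv_sum_list_conv_sum_set_nat
        atLeastLessThanSuc_atLeastAtMost del: upt_Suc)
  then show ?thesis by (simp add: count_sum)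
qed

lemma set_sources: "set (sources n E i) \<subseteq> {1..n}"
  by (auto simp: sources_def)

lemma length_sources:
  assumes "E \<in> networks n r" "i \<in> {1..n}"
  shows "length (sources n E i) = r"
  using assms by (simp add: networks_def sources_def length_concat comp_def
      interv_sum_list_conv_sum_set_nat atLeastLessThanSuc_atLeastAtMost del: upt_Suc)

lemma inflate_in_networks:
  assumes "B \<in> networks n s"
  shows "inflate n g m B \<in> networks n (g * s + m)"
proof -
  have "(\<Sum>u\<in>{1..n}. inflate n g m B u v) = g * s + m" if "v \<in> {1..n}" for v
  proof -
    have "(\<Sum>u\<in>{1..n}. inflate n g m B u v) =
        (\<Sum>u\<in>{1..n}. g * B u v) + (\<Sum>u\<in>{1..n}. if u = v then m else 0)"
      unfolding sum.distrib[symmetric] by (intro sum.cong) (auto simp: inflate_def)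
    also have "\<dots> = g * (\<Sum>u\<in>{1..n}. B u v) + m"
      using that by (simp only: sum_distrib_left sum.delta finite_atLeastAtMost if_True)
    also have "(\<Sum>u\<in>{1..n}. B u v) = s" using assms that by (simp add: networks_def)
    finally show ?thesis .
  qed
  then show ?thesis using assms by (simp add: networks_def inflate_def)
qed

lemma mset_sources_inflate:
  assumes "i \<in> {1..n}"
  shows "mset (sources n (inflate n g m B) i) =
    repeat_mset g (mset (sources n B i)) + replicate_mset m i"
  using assms by (intro multiset_eqI) (auto simp: count_sources inflate_def)

lemma admissible_fields_subsetI:
  assumes "\<And>F. F \<in> response_functions d r \<Longrightarrow> \<exists>F'\<in>response_functions d r'.
      \<forall>x\<in>{1..n} \<rightarrow>\<^sub>E phase_space d. \<forall>i\<in>{1..n}.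
        F' (x i) (map x (sources n E' i)) = F (x i) (map x (sources n E i))"
  shows "admissible_fields n r E d \<subseteq> admissible_fields n r' E' d"
proof
  fix X assume "X \<in> admissible_fields n r E d"
  then obtain F where F: "F \<in> response_functions d r"
    and X: "X = (\<lambda>x\<in>{1..n} \<rightarrow>\<^sub>E phase_space d. \<lambda>i\<in>{1..n}. F (x i) (map x (sources n E i)))"
    unfolding admissible_fields_def by blast
  obtain F' where F': "F' \<in> response_functions d r'"
    "\<forall>x\<in>{1..n} \<rightarrow>\<^sub>E phase_space d. \<forall>i\<in>{1..n}.
        F' (x i) (map x (sources n E' i)) = F (x i) (map x (sources n E i))"
    using assms[OF F] by blast
  have "X = (\<lambda>x\<in>{1..n} \<rightarrow>\<^sub>E phase_space d. \<lambda>i\<in>{1..n}. F' (x i) (map x (sources n E' i)))"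
    unfolding X by (intro restrict_ext) (use F'(2) in auto)
  with F'(1) show "X \<in> admissible_fields n r' E' d"
    unfolding admissible_fields_def by blast
qed

text \<open>This is the instance of Dias and Stewart's theorem (linear equivalence implies O.D.E.
  equivalence) on which the count rests.\<close>

lemma admissible_fields_inflate:
  assumes B: "B \<in> networks n s" and "g > 0"
  shows "admissible_fields n (g * s + m) (inflate n g m B) d = admissible_fields n s B d"
proof (rule subset_antisym; rule admissible_fields_subsetI)
  let ?E = "inflate n g m B" and ?r = "g * s + m"
  note E = inflate_in_networks[OF B, of g m]
  have x_in: "x i \<in> phase_space d" "set (map x (sources n E' i)) \<subseteq> phase_space d"
    if "x \<in> {1..n} \<rightarrow>\<^sub>E phase_space d" "i \<in> {1..n}" for x i E'
    using that set_sources[of n E' i] by (auto dest: PiE_mem)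
  have mset_eq: "mset (map x (sources n ?E i)) =
      repeat_mset g (mset (map x (sources n B i))) + replicate_mset m (x i)"
    if "i \<in> {1..n}" for x :: "nat \<Rightarrow> nat \<Rightarrow> real" and i
    using mset_sources_inflate[OF that, of g m B] by (simp add: image_mset_repeat_mset)
  {
    fix F assume F: "F \<in> response_functions d ?r"
    show "\<exists>F'\<in>response_functions d s. \<forall>x\<in>{1..n} \<rightarrow>\<^sub>E phase_space d. \<forall>i\<in>{1..n}.
        F' (x i) (map x (sources n B i)) = F (x i) (map x (sources n ?E i))"
    proof (intro bexI[OF _ response_function_repeat[OF F]] ballI)
      fix x i assume x: "x \<in> {1..n} \<rightarrow>\<^sub>E phase_space d" and i: "i \<in> {1..n}"
      show "F (x i) (concat (map (replicate g) (map x (sources n B i))) @ replicate m (x i)) =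
          F (x i) (map x (sources n ?E i))"
      proof (rule response_function_symmetric[OF F x_in[OF x i]])
        show "mset (concat (map (replicate g) (map x (sources n B i))) @ replicate m (x i)) =
            mset (map x (sources n ?E i))"
          using mset_eq[OF i, of x] by (simp only: mset_append mset_concat_replicate mset_replicate)
      qed (simp add: length_sources[OF E i])
    qed
  next
    fix F assume F: "F \<in> response_functions d s"
    obtain F' where F': "F' \<in> response_functions d ?r"
      "\<And>x ys zs. x \<in> phase_space d \<Longrightarrow> set ys \<subseteq> phase_space d \<Longrightarrow> length ys = s \<Longrightarrow>
        mset zs = repeat_mset g (mset ys) + replicate_mset m x \<Longrightarrow> F' x zs = F x ys"
      using response_function_extension[OF F \<open>g > 0\<close>, of m] by blast
    then show "\<exists>F'\<in>response_functions d ?r. \<forall>x\<in>{1..n} \<rightarrow>\<^sub>E phase_space d. \<forall>i\<in>{1..n}.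
        F' (x i) (map x (sources n ?E i)) = F (x i) (map x (sources n B i))"
      using x_in mset_eq length_sources[OF B] by (intro bexI[OF _ F'(1)] ballI F'(2)) auto
  }
qed

section \<open>Linear relations forced by O.D.E. equivalence\<close>

lemma sum_list_indicator_eq_count:
  "(\<Sum>v\<leftarrow>vs. if v = u then c else 0) = real (count (mset vs) u) * c"
  by (induction vs) (auto simp: algebra_simps)

text \<open>On \<open>\<real>\<close>, the response function \<open>y\<^sub>1 + \<dots> + y\<^sub>s\<close> turns a network into the linear
  vector field given by its adjacency matrix.\<close>

lemma sum_coupling_in_response_functions:
  "(\<lambda>x ys a. if a = 0 then \<Sum>y\<leftarrow>ys. y 0 else 0) \<in> response_functions 1 s"
proof (rule response_functionsI)
  fix x :: "nat \<Rightarrow> real" and ys ys' :: "(nat \<Rightarrow> real) list" assume "mset ys' = mset ys"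
  then have "(\<Sum>y\<leftarrow>ys'. y 0) = (\<Sum>y\<leftarrow>ys. y 0)" by (rule sum_list_cong_mset)
  then show "(\<lambda>a::nat. if a = 0 then \<Sum>y\<leftarrow>ys'. y 0 else 0) = (\<lambda>a. if a = 0 then \<Sum>y\<leftarrow>ys. y 0 else 0)"
    by (simp only:)
next
  fix b :: nat assume "b < 1"
  have "C_diff k A (\<lambda>z. \<Sum>j\<leftarrow>[1..<Suc s]. z (j, 0))" for k and A :: "(nat \<times> nat) set"
    by (intro C_diff_sum_list C_diff_coordinate)
  with \<open>b < 1\<close> show "C_infinity ({0..s} \<times> {..<1})
      (\<lambda>z. if b = 0 then \<Sum>y\<leftarrow>map (state z) [1..<Suc s]. y 0 else 0)"
    by (simp add: C_infinity_def state_def comp_def del: upt_Suc)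
qed (auto simp: coord_space_def)

text \<open>Let \<open>F\<close> realize for \<open>E\<close> the linear field of \<open>B\<close>. By symmetry, all derivatives of \<open>F\<close> at the
  origin with respect to a coupled state are equal, say to \<open>\<beta>\<close>; let \<open>\<alpha>\<close> be the derivative with
  respect to the internal state. Moving the state of vertex \<open>u\<close> alone changes the equation of
  vertex \<open>i\<close> at the rate \<open>B u i\<close> on one side and, by the chain rule, at the rate
  \<open>\<beta> E u i\<close>, with \<open>\<alpha>\<close> added if \<open>u = i\<close>, on the other.\<close>

lemma admissible_fields_subset_imp_linear:
  assumes B: "B \<in> networks n s" and E: "E \<in> networks n r"
    and sub: "admissible_fields n s B 1 \<subseteq> admissible_fields n r E 1"
  obtains \<alpha> \<beta> :: real where "\<And>u i. u \<in> {1..n} \<Longrightarrow> i \<in> {1..n} \<Longrightarrow>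
    real (B u i) = (if u = i then \<alpha> else 0) + \<beta> * real (E u i)"
proof -
  let ?P = "{1..n} \<rightarrow>\<^sub>E phase_space 1"
  have "(\<lambda>x\<in>?P. \<lambda>i\<in>{1..n}. (\<lambda>a. if a = 0 then \<Sum>y\<leftarrow>map x (sources n B i). y 0 else 0))
      \<in> admissible_fields n s B 1"
    unfolding admissible_fields_def
    by (intro CollectI exI[of _ "\<lambda>x ys a. if a = 0 then \<Sum>y\<leftarrow>ys. y 0 else 0"] conjI
        sum_coupling_in_response_functions refl)
  then obtain F where F: "F \<in> response_functions 1 r"
    and eq: "(\<lambda>x\<in>?P. \<lambda>i\<in>{1..n}. (\<lambda>a. if a = 0 then \<Sum>y\<leftarrow>map x (sources n B i). y 0 else 0)) =
      (\<lambda>x\<in>?P. \<lambda>i\<in>{1..n}. F (x i) (map x (sources n E i)))"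
    using sub unfolding admissible_fields_def by blast
  have field: "F (x i) (map x (sources n E i)) 0 = (\<Sum>v\<leftarrow>sources n B i. x v 0)"
    if "x \<in> ?P" "i \<in> {1..n}" for x i
    using fun_cong[OF fun_cong[OF fun_cong[OF eq, of x], of i], of 0] that by (simp add: comp_def)
  define I :: "(nat \<times> nat) set" where "I = {0..r} \<times> {..<1}"
  define f where "f = (\<lambda>z. F (state z 0) (map (state z) [1..<Suc r]) 0)"
  have "C_diff (Suc 0) I f"
    using response_function_smooth[OF F, of 0] by (simp add: C_infinity_def I_def f_def)
  then have "\<exists>g. \<forall>p\<in>I. continuous_on (coord_space I) (g p) \<and>
      (\<forall>x\<in>coord_space I. ((\<lambda>t. f (x(p := t))) has_real_derivative g p x) (at (x p)))"
    unfolding C_diff.simps by metis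
  then obtain g where g: "\<And>p. p \<in> I \<Longrightarrow> continuous_on (coord_space I) (g p)"
    and df: "\<And>p x. p \<in> I \<Longrightarrow> x \<in> coord_space I \<Longrightarrow>
      ((\<lambda>t. f (x(p := t))) has_real_derivative g p x) (at (x p))"
    by blast
  let ?o = "\<lambda>_. 0 :: real"
  define \<alpha> \<beta> where "\<alpha> = g (0, 0) ?o" and "\<beta> = g (1, 0) ?o"
  have zero: "?o \<in> coord_space A" for A :: "'c set" by (simp add: coord_space_def)
  have g_eq: "g (k, 0) ?o = \<beta>" if "k \<in> {1..r}" for k
  proof -
    \<comment> \<open>Moving one input only gives the same list up to order, whichever input it is.\<close>
    have f_single: "f (?o((j, 0) := t)) =
        F ?o ((replicate r ?o)[j - 1 := (\<lambda>a. if a = 0 then t else 0)]) 0" if "j \<in> {1..r}" for j t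
    proof -
      have "map (state (?o((j, 0) := t))) [1..<Suc r] =
          (replicate r ?o)[j - 1 := (\<lambda>a. if a = 0 then t else 0)]"
        using that by (intro nth_equalityI)
          (auto simp: state_def nth_list_update fun_eq_iff simp del: upt_Suc)
      moreover have "state (?o((j, 0) := t)) 0 = ?o" using that by (auto simp: state_def)
      ultimately show ?thesis unfolding f_def by simp
    qed
    have r: "1 \<in> {1..r}" using that by simp
    let ?l = "\<lambda>j t. (replicate r ?o)[j - 1 := (\<lambda>a::nat. if a = 0 then t else 0)]"
    have "F ?o (?l k t) = F ?o (?l 1 t)" for t
    proof (rule response_function_symmetric[OF F zero])
      show "set (?l 1 t) \<subseteq> phase_space 1"
        by (rule order_trans[OF set_update_subset_insert]) (auto simp: coord_space_def)
      show "mset (?l k t) = mset (?l 1 t)" using that by (auto simp: mset_update)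
    qed simp
    then have eq: "(\<lambda>t. f (?o((k, 0) := t))) = (\<lambda>t. f (?o((1, 0) := t)))"
      unfolding f_single[OF that] f_single[OF r] by (simp only:)
    have "((\<lambda>t. f (?o((k, 0) := t))) has_real_derivative g (k, 0) ?o) (at 0)"
      by (rule df[OF _ zero]) (use that in \<open>auto simp: I_def\<close>)
    moreover have "((\<lambda>t. f (?o((1, 0) := t))) has_real_derivative \<beta>) (at 0)"
      unfolding \<beta>_def by (rule df[OF _ zero]) (use that in \<open>auto simp: I_def\<close>)
    ultimately show ?thesis unfolding eq by (rule DERIV_unique)
  qed
  have "real (B u i) = (if u = i then \<alpha> else 0) + \<beta> * real (E u i)"
    if u: "u \<in> {1..n}" and i: "i \<in> {1..n}" for u i
  proof -
    define vs where "vs = i # sources n E i"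
    have len: "length (sources n E i) = r" using length_sources[OF E i] .
    \<comment> \<open>The coordinates of the domain of \<open>F\<close> that carry the state of vertex \<open>u\<close> in equation \<open>i\<close>.\<close>
    define S where "S = {p \<in> I. vs ! fst p = u}"
    have "f (\<lambda>p. if p \<in> S then t else 0) = real (B u i) * t" for t
    proof -
      define x where "x = (\<lambda>v\<in>{1..n}. (\<lambda>a::nat. if v = u \<and> a = 0 then t else 0))"
      have x: "x \<in> ?P" by (auto simp: x_def coord_space_def)
      have vs: "vs ! k \<in> {1..n}" if "k \<le> r" for k
        using that i len nth_mem[of k vs] set_sources[of n E i] by (auto simp: vs_def)
      have state_x: "state (\<lambda>p. if p \<in> S then t else 0) k = x (vs ! k)" if "k \<le> r" for k
        using that vs[OF that] by (auto simp: state_def x_def S_def I_def)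
      have "map (state (\<lambda>p. if p \<in> S then t else 0)) [1..<Suc r] = map x (sources n E i)"
        using len state_x by (intro nth_equalityI) (auto simp: vs_def simp del: upt_Suc)
      then have "f (\<lambda>p. if p \<in> S then t else 0) = F (x i) (map x (sources n E i)) 0"
        using state_x[of 0] by (simp add: f_def vs_def)
      also have "\<dots> = (\<Sum>v\<leftarrow>sources n B i. x v 0)" by (rule field[OF x i])
      also have "\<dots> = (\<Sum>v\<leftarrow>sources n B i. if v = u then t else 0)"
        using set_sources[of n B i] by (intro arg_cong[of _ _ sum_list] map_cong) (auto simp: x_def)
      also have "\<dots> = real (B u i) * t"
        unfolding sum_list_indicator_eq_count count_sources using u by simp
      finally show ?thesis .
    qed
    moreover have "((\<lambda>t. f (\<lambda>p. if p \<in> S then t else ?o p)) has_real_derivative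
        (\<Sum>p\<in>S. g p (\<lambda>p. if p \<in> S then 0 else ?o p))) (at 0)"
    proof (rule has_real_derivative_simultaneous[where I = I])
      show "finite S" "S \<subseteq> I" by (auto simp: S_def I_def)
    qed (fact g df zero)+
    ultimately have "((\<lambda>t. real (B u i) * t) has_real_derivative (\<Sum>p\<in>S. g p ?o)) (at 0)"
      by simp
    moreover have "((\<lambda>t. real (B u i) * t) has_real_derivative real (B u i)) (at 0)"
      by (auto intro!: derivative_eq_intros)
    ultimately have "real (B u i) = (\<Sum>p\<in>S. g p ?o)" using DERIV_unique by blast
    also have "S = (\<lambda>k. (k, 0)) ` {k \<in> {..r}. vs ! k = u}"
      by (auto simp: S_def I_def)
    also have "(\<Sum>p\<in>\<dots>. g p ?o) = (\<Sum>k\<in>{k \<in> {..r}. vs ! k = u}. g (k, 0) ?o)"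
      by (subst sum.reindex) (auto simp: inj_on_def)
    also have "\<dots> = (\<Sum>k\<le>r. if vs ! k = u then g (k, 0) ?o else 0)"
      by (rule sum.inter_filter) simp
    also have "\<dots> = (if u = i then \<alpha> else 0) + (\<Sum>k<r. if sources n E i ! k = u then \<beta> else 0)"
      unfolding lessThan_Suc_atMost[symmetric] sum.lessThan_Suc_shift
      by (auto simp: vs_def \<alpha>_def g_eq intro!: sum.cong arg_cong2[of _ _ _ _ "(+)"])
    also have "(\<Sum>k<r. if sources n E i ! k = u then \<beta> else 0) =
        (\<Sum>v\<leftarrow>sources n E i. if v = u then \<beta> else 0)"
      by (simp add: sum_list_sum_nth len atLeast0LessThan)
    also have "\<dots> = \<beta> * real (E u i)"
      unfolding sum_list_indicator_eq_count count_sources using u by simp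
    finally show ?thesis .
  qed
  then show thesis by (rule that)
qed

section \<open>Reduced networks\<close>

definition content :: "nat \<Rightarrow> network \<Rightarrow> nat" where
  "content n E = Gcd ((\<lambda>(u, v). E u v) ` ({1..n} \<times> {1..n}))"

text \<open>A normal form of natural matrices under scaling and adding multiples of the identity. Among
  the connected networks with at least two vertices, these are the minimal ones.\<close>

definition reduced :: "nat \<Rightarrow> network \<Rightarrow> bool" where
  "reduced n B \<longleftrightarrow> (\<exists>v\<in>{1..n}. B v v = 0) \<and> content n B = 1"

lemma content_scale: "content n (\<lambda>u v. g * E u v) = g * content n E"
proof -
  have "(\<lambda>(u, v). g * E u v) ` A = (*) g ` (\<lambda>(u, v). E u v) ` A" for A
    by (simp add: image_image case_prod_unfold)
  then show ?thesis unfolding content_def by (simp add: Gcd_mult)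
qed

lemma content_cong:
  assumes "\<And>u v. u \<in> {1..n} \<Longrightarrow> v \<in> {1..n} \<Longrightarrow> E u v = E' u v"
  shows "content n E = content n E'"
  unfolding content_def using assms by (intro arg_cong[of _ _ Gcd] image_cong) auto

lemma content_permute:
  assumes "bij_betw \<phi> {1..n} {1..n}"
  shows "content n (\<lambda>u v. E (\<phi> u) (\<phi> v)) = content n E"
proof -
  have "map_prod \<phi> \<phi> ` ({1..n} \<times> {1..n}) = {1..n} \<times> {1..n}"
    using assms by (simp add: map_prod_surj_on bij_betw_imp_surj_on)
  moreover have "(\<lambda>(u, v). E (\<phi> u) (\<phi> v)) ` A = (\<lambda>(u, v). E u v) ` map_prod \<phi> \<phi> ` A" for A
    by (simp add: image_image case_prod_unfold)
  ultimately show ?thesis unfolding content_def by simp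
qed

lemma content_dvd: "u \<in> {1..n} \<Longrightarrow> v \<in> {1..n} \<Longrightarrow> content n E dvd E u v"
  unfolding content_def by (rule Gcd_dvd) force

lemma networks_degree_unique:
  assumes "E \<in> networks n r" "E \<in> networks n s" "n \<ge> 1"
  shows "r = s"
  using assms by (force simp: networks_def)

lemma num_edges_eq: "E \<in> networks n r \<Longrightarrow> num_edges n E = n * r"
  unfolding num_edges_def by (subst sum.swap) (simp add: networks_def)

text \<open>Subtract the least diagonal entry from the diagonal, then divide by the content. The edge
  between distinct vertices survives the subtraction, so that the content is not \<open>0\<close>, and it
  makes the degree of the quotient positive.\<close>

lemma reduced_decomposition:
  assumes E: "E \<in> networks n r" and edge: "u\<^sub>0 \<in> {1..n}" "v\<^sub>0 \<in> {1..n}" "u\<^sub>0 \<noteq> v\<^sub>0" "E u\<^sub>0 v\<^sub>0 > 0"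
  obtains g m s B where "g > 0" "B \<in> networks n s" "reduced n B" "E = inflate n g m B"
    "r = g * s + m" "s > 0"
proof -
  define m where "m = Min ((\<lambda>v. E v v) ` {1..n})"
  have m_le: "m \<le> E v v" if "v \<in> {1..n}" for v
    using that by (simp add: m_def)
  have "m \<in> (\<lambda>v. E v v) ` {1..n}"
    unfolding m_def using edge(1) by (intro Min_in) auto
  then obtain w where w: "w \<in> {1..n}" "E w w = m" by auto
  define C where "C = (\<lambda>u v. E u v - (if u = v \<and> u \<in> {1..n} then m else 0))"
  define g where "g = content n C"
  define B where "B = (\<lambda>u v. C u v div g)"
  have outside: "C u v = 0" if "u \<notin> {1..n} \<or> v \<notin> {1..n}" for u v
    using E that by (auto simp: networks_def C_def)
  have "g dvd C u\<^sub>0 v\<^sub>0" unfolding g_def by (rule content_dvd) fact+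
  moreover have C_edge: "C u\<^sub>0 v\<^sub>0 > 0" using edge by (simp add: C_def)
  ultimately have g_pos: "g > 0" by (auto intro: Nat.gr0I)
  have C_eq: "C u v = g * B u v" for u v
    using content_dvd[of u n v C] outside[of u v]
    by (cases "u \<in> {1..n} \<and> v \<in> {1..n}") (auto simp: B_def g_def)
  have E_eq: "E = inflate n g m B"
    using m_le by (auto simp: inflate_def fun_eq_iff C_eq[symmetric] C_def)
  have "C = (\<lambda>u v. g * B u v)" by (intro ext C_eq)
  then have "content n C = g * content n B" by (simp only: content_scale)
  then have "g = g * content n B" by (simp only: g_def[symmetric])
  then have "content n B = 1" using g_pos by simp
  moreover have "B w w = 0" using w by (simp add: B_def C_def)
  ultimately have red: "reduced n B" using w by (auto simp: reduced_def)
  define s where "s = (r - m) div g"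
  have "(\<Sum>u\<in>{1..n}. B u v) = s" if v: "v \<in> {1..n}" for v
  proof -
    have "r = (\<Sum>u\<in>{1..n}. g * B u v + (if u = v then m else 0))"
    proof -
      have "r = (\<Sum>u\<in>{1..n}. E u v)" using E v by (simp add: networks_def)
      also have "\<dots> = (\<Sum>u\<in>{1..n}. g * B u v + (if u = v then m else 0))"
        by (intro sum.cong) (auto simp: E_eq inflate_def)
      finally show ?thesis .
    qed
    also have "\<dots> = g * (\<Sum>u\<in>{1..n}. B u v) + m"
      using v by (simp only: sum.distrib sum_distrib_left sum.delta finite_atLeastAtMost if_True)
    finally show ?thesis using g_pos by (simp add: s_def)
  qed
  then have B: "B \<in> networks n s" using outside by (simp add: networks_def B_def)
  have "r = g * s + m"
    using networks_degree_unique[OF E] inflate_in_networks[OF B, of g m] edge(1)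
    by (simp add: E_eq)
  moreover have "s > 0"
  proof -
    have "B u\<^sub>0 v\<^sub>0 > 0" using C_edge by (simp add: C_eq)
    moreover have "B u\<^sub>0 v\<^sub>0 \<le> (\<Sum>u\<in>{1..n}. B u v\<^sub>0)" using edge(1) by (intro member_le_sum) auto
    moreover have "(\<Sum>u\<in>{1..n}. B u v\<^sub>0) = s" using B edge(2) by (simp add: networks_def)
    ultimately show ?thesis by simp
  qed
  ultimately show thesis using g_pos B red E_eq by (intro that)
qed

section \<open>Connectedness\<close>

lemma connected_network_has_edge:
  assumes "connected_network n E" "n \<ge> 2"
  obtains u v where "u \<in> {1..n}" "v \<in> {1..n}" "u \<noteq> v" "E u v > 0"
proof -
  let ?R = "{(a, b). a \<in> {1..n} \<and> b \<in> {1..n} \<and> (E a b > 0 \<or> E b a > 0)}"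
  have "\<not> ?R \<subseteq> Id"
  proof
    assume sub: "?R \<subseteq> Id"
    have "a = b" if "(a, b) \<in> ?R\<^sup>*" for a b
      using that by (induction rule: rtrancl_induct) (use sub in auto)
    moreover have "(1, 2) \<in> ?R\<^sup>*"
      by (rule assms(1)[unfolded connected_network_def, rule_format]) (use assms(2) in auto)
    ultimately have "(1::nat) = 2" .
    then show False by simp
  qed
  then show thesis using that by blast
qed

text \<open>Inflating only adds loops to the underlying simple graph, and these do not change its
  reflexive closure.\<close>

lemma connected_network_inflate:
  assumes "g > 0"
  shows "connected_network n (inflate n g m B) \<longleftrightarrow> connected_network n B"
proof -
  let ?R = "\<lambda>E. {(a, b). a \<in> {1..n} \<and> b \<in> {1..n} \<and> (E a b > (0::nat) \<or> E b a > 0)}"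
  have "(?R (inflate n g m B))\<^sup>= = (?R B)\<^sup>=" using assms by (auto simp: inflate_def)
  then have "((?R (inflate n g m B))\<^sup>=)\<^sup>* = ((?R B)\<^sup>=)\<^sup>*" by (rule arg_cong)
  then have "(?R (inflate n g m B))\<^sup>* = (?R B)\<^sup>*" unfolding rtrancl_reflcl .
  then show ?thesis unfolding connected_network_def by simp
qed

section \<open>Isomorphism of inflated networks\<close>

lemma equivp_network_iso: "equivp (network_iso n)"
proof (rule equivpI)
  show "reflp (network_iso n)"
    unfolding reflp_def network_iso_def by (intro allI exI[of _ id]) auto
  show "symp (network_iso n)"
  proof (rule sympI)
    fix E E' assume "network_iso n E E'"
    then obtain \<phi> where \<phi>: "bij_betw \<phi> {1..n} {1..n}"
      and eq: "\<forall>u\<in>{1..n}. \<forall>v\<in>{1..n}. E' (\<phi> u) (\<phi> v) = E u v"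
      unfolding network_iso_def by blast
    have "E (inv_into {1..n} \<phi> u) (inv_into {1..n} \<phi> v) = E' u v"
      if "u \<in> {1..n}" "v \<in> {1..n}" for u v
      using eq that bij_betw_inv_into_right[OF \<phi>]
        bij_betwE[OF bij_betw_inv_into[OF \<phi>]] by metis
    then show "network_iso n E' E"
      unfolding network_iso_def using bij_betw_inv_into[OF \<phi>] by blast
  qed
  show "transp (network_iso n)"
  proof (rule transpI)
    fix E E' E'' assume "network_iso n E E'" "network_iso n E' E''"
    then obtain \<phi> \<psi> where \<phi>: "bij_betw \<phi> {1..n} {1..n}" and \<psi>: "bij_betw \<psi> {1..n} {1..n}"
      and "\<forall>u\<in>{1..n}. \<forall>v\<in>{1..n}. E' (\<phi> u) (\<phi> v) = E u v"
      and "\<forall>u\<in>{1..n}. \<forall>v\<in>{1..n}. E'' (\<psi> u) (\<psi> v) = E' u v"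
      unfolding network_iso_def by blast
    with bij_betwE[OF \<phi>] show "network_iso n E E''"
      unfolding network_iso_def by (intro exI[of _ "\<psi> \<circ> \<phi>"]) (auto intro: bij_betw_trans)
  qed
qed

text \<open>The decomposition is an isomorphism invariant: as reduced networks have a vertex without
  loops, \<open>m\<close> is the least diagonal entry of \<open>g B + m I\<close>, and as they have content \<open>1\<close>, \<open>g\<close> is the
  content of what remains.\<close>

lemma network_iso_inflate_iff:
  assumes B: "reduced n B" and B': "reduced n B'" and g: "g > 0" "g' > 0"
  shows "network_iso n (inflate n g m B) (inflate n g' m' B') \<longleftrightarrow>
    g = g' \<and> m = m' \<and> network_iso n B B'"
proof
  assume "network_iso n (inflate n g m B) (inflate n g' m' B')"
  then obtain \<phi> where \<phi>: "bij_betw \<phi> {1..n} {1..n}"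
    and eq: "\<And>u v. u \<in> {1..n} \<Longrightarrow> v \<in> {1..n} \<Longrightarrow>
      inflate n g' m' B' (\<phi> u) (\<phi> v) = inflate n g m B u v"
    unfolding network_iso_def by blast
  have \<phi>_in: "\<phi> u \<in> {1..n}" if "u \<in> {1..n}" for u using bij_betwE[OF \<phi>] that by blast
  have \<phi>_eq: "\<phi> u = \<phi> v \<longleftrightarrow> u = v" if "u \<in> {1..n}" "v \<in> {1..n}" for u v
    using inj_on_eq_iff[OF bij_betw_imp_inj_on[OF \<phi>] that] .
  have eq': "g' * B' (\<phi> u) (\<phi> v) + (if u = v then m' else 0) = g * B u v + (if u = v then m else 0)"
    if "u \<in> {1..n}" "v \<in> {1..n}" for u v
    using eq[OF that] \<phi>_in[OF that(1)] \<phi>_eq[OF that] that by (auto simp: inflate_def)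
  have "m = m'"
  proof (rule antisym)
    obtain v where "v \<in> {1..n}" "B v v = 0" using B by (auto simp: reduced_def)
    then show "m' \<le> m" using eq'[of v v] by simp
    obtain w where w: "w \<in> {1..n}" "B' w w = 0" using B' by (auto simp: reduced_def)
    then have "w \<in> \<phi> ` {1..n}" using bij_betw_imp_surj_on[OF \<phi>] by simp
    then obtain v where "v \<in> {1..n}" "\<phi> v = w" by blast
    then show "m \<le> m'" using eq'[of v v] w by simp
  qed
  then have scaled: "g' * B' (\<phi> u) (\<phi> v) = g * B u v" if "u \<in> {1..n}" "v \<in> {1..n}" for u v
    using eq'[OF that] by (simp only: add_right_cancel)
  have "g' * content n (\<lambda>u v. B' (\<phi> u) (\<phi> v)) = g * content n B"
    unfolding content_scale[symmetric] by (rule content_cong) (rule scaled)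
  then have "g = g'" using B B' by (simp add: content_permute[OF \<phi>] reduced_def)
  with scaled g have "B' (\<phi> u) (\<phi> v) = B u v" if "u \<in> {1..n}" "v \<in> {1..n}" for u v
    using that by simp
  then have "network_iso n B B'" using \<phi> unfolding network_iso_def by blast
  with \<open>g = g'\<close> \<open>m = m'\<close> show "g = g' \<and> m = m' \<and> network_iso n B B'" by simp
next
  assume "g = g' \<and> m = m' \<and> network_iso n B B'"
  then obtain \<phi> where \<phi>: "bij_betw \<phi> {1..n} {1..n}"
    and eq: "\<forall>u\<in>{1..n}. \<forall>v\<in>{1..n}. B' (\<phi> u) (\<phi> v) = B u v" and "g = g'" "m = m'"
    unfolding network_iso_def by blast
  moreover have "\<phi> u = \<phi> v \<longleftrightarrow> u = v" "\<phi> u \<in> {1..n}" if "u \<in> {1..n}" "v \<in> {1..n}" for u v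
    using inj_on_eq_iff[OF bij_betw_imp_inj_on[OF \<phi>] that] bij_betwE[OF \<phi>] that by blast+
  ultimately show "network_iso n (inflate n g m B) (inflate n g' m' B')"
    unfolding network_iso_def by (intro exI[of _ \<phi>]) (auto simp: inflate_def)
qed

section \<open>Minimal networks are the reduced ones\<close>

text \<open>A vertex without loops in \<open>B\<close> gives \<open>\<alpha> = - \<beta> m\<close>, where \<open>m\<close> is its number of loops in \<open>E\<close>, so
  that \<open>B = \<beta> (E - m I)\<close>. An edge of \<open>B\<close> between distinct vertices shows \<open>\<beta> > 0\<close>, hence \<open>E - m I\<close>
  has natural entries. Comparing contents shows that \<open>1 / \<beta>\<close> is the content of \<open>E - m I\<close>, a
  positive integer, so the degree of \<open>B\<close> is at most that of \<open>E - m I\<close>.\<close>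

lemma reduced_degree_le:
  fixes \<alpha> \<beta> :: real
  assumes B: "B \<in> networks n s" "reduced n B"
    and edge: "u\<^sub>0 \<in> {1..n}" "v\<^sub>0 \<in> {1..n}" "u\<^sub>0 \<noteq> v\<^sub>0" "B u\<^sub>0 v\<^sub>0 > 0"
    and E: "E \<in> networks n r"
    and rel: "\<And>u v. u \<in> {1..n} \<Longrightarrow> v \<in> {1..n} \<Longrightarrow>
      real (B u v) = (if u = v then \<alpha> else 0) + \<beta> * real (E u v)"
  shows "s \<le> r"
proof -
  obtain w where w: "w \<in> {1..n}" "B w w = 0" using B(2) by (auto simp: reduced_def)
  define m where "m = E w w"
  have \<alpha>: "\<alpha> = - \<beta> * real m" using rel[OF w(1) w(1)] w(2) by (simp add: m_def)
  have "\<beta> * real (E u\<^sub>0 v\<^sub>0) > 0" using rel[OF edge(1,2)] edge(3,4) by simp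
  then have \<beta>: "\<beta> > 0" by (simp add: zero_less_mult_iff)
  define C where "C = (\<lambda>u v. E u v - (if u = v then m else 0))"
  have BC: "real (B u v) = \<beta> * real (C u v)" if "u \<in> {1..n}" "v \<in> {1..n}" for u v
  proof (cases "u = v")
    case True
    have "real (B u v) = \<beta> * (real (E u v) - real m)"
      using rel[OF that] True \<alpha> by (simp add: algebra_simps)
    moreover from this have "m \<le> E u v"
      using \<beta> by (metis of_nat_0_le_iff of_nat_le_iff diff_ge_0_iff_ge zero_le_mult_iff less_le_not_le)
    ultimately show ?thesis using True by (simp add: C_def of_nat_diff)
  qed (use rel[OF that] in \<open>simp add: C_def\<close>)
  define b c where "b = B u\<^sub>0 v\<^sub>0" and "c = C u\<^sub>0 v\<^sub>0"
  have b: "b > 0" and bc: "real b = \<beta> * real c"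
    using edge BC by (auto simp: b_def c_def)
  \<comment> \<open>The ratio \<open>\<beta> = b / c\<close> is eliminated so that contents of natural matrices can be compared.\<close>
  have cross: "c * B u v = b * C u v" if "u \<in> {1..n}" "v \<in> {1..n}" for u v
  proof -
    have "real (c * B u v) = real (b * C u v)" using BC[OF that] bc by simp
    then show ?thesis using of_nat_eq_iff by blast
  qed
  have "c * content n B = b * content n C"
    unfolding content_scale[symmetric] by (rule content_cong) (rule cross)
  then have c: "c = b * content n C" using B(2) by (simp add: reduced_def)
  moreover have "c > 0" using b bc by (intro Nat.gr0I) auto
  ultimately have "content n C > 0" by (intro Nat.gr0I) auto
  have "c * s = (\<Sum>u\<in>{1..n}. c * B u w)"
    using B(1) w(1) by (simp add: networks_def flip: sum_distrib_left)
  also have "\<dots> = b * (\<Sum>u\<in>{1..n}. C u w)"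
    unfolding sum_distrib_left using w(1) by (intro sum.cong refl cross)
  also have "(\<Sum>u\<in>{1..n}. C u w) \<le> (\<Sum>u\<in>{1..n}. E u w)"
    by (intro sum_mono) (simp add: C_def)
  also have "\<dots> = r" using E w(1) by (simp add: networks_def)
  finally have "content n C * s \<le> r" using b by (simp add: c)
  then show "s \<le> r" using \<open>content n C > 0\<close> by (metis One_nat_def Suc_leI le_trans mult_le_mono1 mult_1)
qed

lemma ode_equivalent_inflate:
  assumes "B \<in> networks n s" "g > 0"
  shows "ode_equivalent n (g * s + m) (inflate n g m B) s B"
  unfolding ode_equivalent_def
  using assms equivp_reflp[OF equivp_network_iso] admissible_fields_inflate[OF assms]
  by blast

text \<open>A network \<open>g B + m I\<close> with reduced \<open>B\<close> is equivalent to \<open>B\<close>, which has smaller degree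
  unless \<open>g = 1\<close> and \<open>m = 0\<close>. Conversely, no network equivalent to a reduced one can have smaller
  degree, by the linear relation between them.\<close>

lemma minimal_network_iff_reduced:
  assumes "n \<ge> 2" and E: "E \<in> networks n r" and conn: "connected_network n E"
  shows "minimal_network n r E \<longleftrightarrow> reduced n E"
proof
  obtain u v where edge: "u \<in> {1..n}" "v \<in> {1..n}" "u \<noteq> v" "E u v > 0"
    using connected_network_has_edge[OF conn \<open>n \<ge> 2\<close>] .
  {
    assume min: "minimal_network n r E"
    obtain g m s B where g: "g > 0" and B: "B \<in> networks n s" "reduced n B"
      and E_eq: "E = inflate n g m B" and r: "r = g * s + m" and "s > 0"
      using reduced_decomposition[OF E edge] .
    have "num_edges n E \<le> num_edges n B"
      using min B(1) ode_equivalent_inflate[OF B(1) g, of m]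
      unfolding minimal_network_def r E_eq by blast
    then have le: "g * s + m \<le> s"
      using \<open>n \<ge> 2\<close> by (simp add: num_edges_eq[OF E] num_edges_eq[OF B(1)] r)
    with le g have "m = 0" "g * s \<le> 1 * s" by (cases g; simp)+
    with \<open>s > 0\<close> g have "g = 1" unfolding mult_le_cancel2 by linarith
    with \<open>m = 0\<close> E_eq B(2) show "reduced n E" by (simp add: inflate_def cong: if_cong)
  next
    assume red: "reduced n E"
    show "minimal_network n r E"
      unfolding minimal_network_def
    proof (intro allI ballI impI)
      fix s E' assume E': "E' \<in> networks n s" and "ode_equivalent n r E s E'"
      then obtain E'' where E'': "E'' \<in> networks n s"
        and adm: "admissible_fields n r E 1 = admissible_fields n s E'' 1"
        unfolding ode_equivalent_def by blast
      obtain \<alpha> \<beta> :: real where "\<And>u i. u \<in> {1..n} \<Longrightarrow> i \<in> {1..n} \<Longrightarrow>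
          real (E u i) = (if u = i then \<alpha> else 0) + \<beta> * real (E'' u i)"
        using admissible_fields_subset_imp_linear[OF E E''] adm by blast
      then have "r \<le> s" by (rule reduced_degree_le[OF E red edge E''])
      then show "num_edges n E \<le> num_edges n E'"
        by (simp add: num_edges_eq[OF E] num_edges_eq[OF E'])
    qed
  }
qed

section \<open>Counting isomorphism classes\<close>

text \<open>Classes of a set that is partitioned into faithful copies of the \<open>S i\<close>, inequivalent for
  distinct \<open>i\<close>, can be counted in each copy separately: the images of the classes of the \<open>S i\<close>
  are exactly the classes of the union.\<close>

lemma card_quotient_Sigma:
  fixes P :: "'a \<Rightarrow> 'a \<Rightarrow> bool" and f :: "'i \<Rightarrow> 'a \<Rightarrow> 'a"
  defines "R \<equiv> \<lambda>A. {(x, y). x \<in> A \<and> y \<in> A \<and> P x y}"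
  assumes P: "equivp P" and fin: "finite I" "\<And>i. i \<in> I \<Longrightarrow> finite (S i)"
    and iff: "\<And>i j x y. i \<in> I \<Longrightarrow> j \<in> I \<Longrightarrow> x \<in> S i \<Longrightarrow> y \<in> S j \<Longrightarrow>
      P (f i x) (f j y) \<longleftrightarrow> i = j \<and> P x y"
    and T: "T = (\<Union>i\<in>I. f i ` S i)"
  shows "card (T // R T) = (\<Sum>i\<in>I. card (S i // R (S i)))"
proof -
  have image_class: "f i ` (R (S i) `` {x}) = R T `` {f i x}" if "i \<in> I" "x \<in> S i" for i x
  proof (intro equalityI subsetI)
    fix y assume "y \<in> R T `` {f i x}"
    then obtain j x' where "j \<in> I" "x' \<in> S j" "y = f j x'" "P (f i x) (f j x')"
      by (auto simp: R_def T)
    with iff[of i j x x'] that show "y \<in> f i ` (R (S i) `` {x})" by (auto simp: R_def)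
  next
    fix y assume "y \<in> f i ` (R (S i) `` {x})"
    then obtain x' where "x' \<in> S i" "P x x'" "y = f i x'" by (auto simp: R_def)
    with iff[of i i x x'] that show "y \<in> R T `` {f i x}" by (auto simp: R_def T)
  qed
  have "bij_betw (\<lambda>(i, X). f i ` X) (SIGMA i:I. S i // R (S i)) (T // R T)"
  proof (intro bij_betw_imageI)
    show "(\<lambda>(i, X). f i ` X) ` (SIGMA i:I. S i // R (S i)) = T // R T"
    proof (intro equalityI subsetI)
      fix Y assume "Y \<in> (\<lambda>(i, X). f i ` X) ` (SIGMA i:I. S i // R (S i))"
      then obtain i x where "i \<in> I" "x \<in> S i" "Y = f i ` (R (S i) `` {x})"
        by (auto elim!: quotientE)
      then show "Y \<in> T // R T" using image_class by (auto simp: T intro!: quotientI)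
    next
      fix Y assume "Y \<in> T // R T"
      then obtain i x where ix: "i \<in> I" "x \<in> S i" "Y = R T `` {f i x}"
        by (auto simp: T elim!: quotientE)
      then have "Y = f i ` (R (S i) `` {x})" using image_class by simp
      then show "Y \<in> (\<lambda>(i, X). f i ` X) ` (SIGMA i:I. S i // R (S i))"
        using ix by (intro image_eqI[of _ _ "(i, R (S i) `` {x})"]) (auto intro: quotientI)
    qed
    show "inj_on (\<lambda>(i, X). f i ` X) (SIGMA i:I. S i // R (S i))"
    proof (rule inj_onI, clarsimp elim!: quotientE)
      fix i j x y
      assume ij: "i \<in> I" "j \<in> I" and xy: "x \<in> S i" "y \<in> S j"
        and "f i ` (R (S i) `` {x}) = f j ` (R (S j) `` {y})"
      moreover have "f i x \<in> f i ` (R (S i) `` {x})" using xy equivp_reflp[OF P] by (auto simp: R_def)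
      ultimately have "f i x \<in> R T `` {f j y}" using image_class by simp
      then have "P (f j y) (f i x)" by (simp add: R_def)
      then have ji: "j = i" and "P y x" using iff ij xy by auto
      then show "i = j \<and> R (S i) `` {x} = R (S j) `` {y}"
        using P xy unfolding ji equivp_def by (auto simp: R_def)
    qed
  qed
  then have "card (T // R T) = card (SIGMA i:I. S i // R (S i))" by (metis bij_betw_same_card)
  also have "\<dots> = (\<Sum>i\<in>I. card (S i // R (S i)))"
  proof (rule card_SigmaI)
    have "S i // R (S i) \<subseteq> Pow (S i)" for i by (auto simp: R_def quotient_def)
    then show "\<forall>i\<in>I. finite (S i // R (S i))" using fin(2) by (meson finite_Pow_iff finite_subset)
  qed fact
  finally show ?thesis .
qed

lemma finite_networks: "finite (networks n r)"
proof (rule finite_subset)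
  let ?rows = "{h. \<forall>v. (v \<in> {1..n} \<longrightarrow> h v \<in> {..r}) \<and> (v \<notin> {1..n} \<longrightarrow> h v = (0::nat))}"
  show "finite {E. \<forall>u. (u \<in> {1..n} \<longrightarrow> E u \<in> ?rows) \<and> (u \<notin> {1..n} \<longrightarrow> E u = (\<lambda>_. 0))}"
    by (intro finite_set_of_finite_funs) auto
  have "E u v \<le> r" if "E \<in> networks n r" "u \<in> {1..n}" "v \<in> {1..n}" for E u v
    using that member_le_sum[of u "{1..n}" "\<lambda>u. E u v"] by (simp add: networks_def)
  then show "networks n r \<subseteq>
      {E. \<forall>u. (u \<in> {1..n} \<longrightarrow> E u \<in> ?rows) \<and> (u \<notin> {1..n} \<longrightarrow> E u = (\<lambda>_. 0))}"
    by (auto simp: networks_def fun_eq_iff)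
qed

text \<open>The connected networks of degree \<open>r\<close> are indexed by the pairs \<open>(s, g)\<close> with \<open>g s \<le> r\<close> and a
  reduced connected network of degree \<open>s\<close>; the number \<open>m = r - g s\<close> of added loops is
  determined.\<close>

lemma K_eq_sum_M:
  assumes "n \<ge> 2"
  shows "K n r = (\<Sum>s=1..r. (r div s) * M n s)"
proof -
  define S where "S s = {B \<in> networks n s. connected_network n B \<and> reduced n B}" for s
  define I where "I = (SIGMA s:{1..r}. {1..r div s})"
  define f where "f = (\<lambda>(s, g). inflate n g (r - g * s))"
  have M: "M n s = card (S s // {(E, E'). E \<in> S s \<and> E' \<in> S s \<and> network_iso n E E'})" for s
  proof -
    have "{E \<in> networks n s. connected_network n E \<and> minimal_network n s E} = S s"
      using minimal_network_iff_reduced[OF assms] by (auto simp: S_def)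
    then show ?thesis by (simp add: M_def card_up_to_iso_def)
  qed
  have le: "g * s \<le> r" "g > 0" if "(s, g) \<in> I" for s g
    using that by (auto simp: I_def less_eq_div_iff_mult_less_eq)
  have T: "{E \<in> networks n r. connected_network n E} = (\<Union>i\<in>I. f i ` S (fst i))"
  proof (intro equalityI subsetI)
    fix E assume "E \<in> {E \<in> networks n r. connected_network n E}"
    then have E: "E \<in> networks n r" and conn: "connected_network n E" by auto
    obtain u v where edge: "u \<in> {1..n}" "v \<in> {1..n}" "u \<noteq> v" "E u v > 0"
      using connected_network_has_edge[OF conn assms] .
    obtain g m s B where g: "g > 0" and B: "B \<in> networks n s" "reduced n B"
      and E_eq: "E = inflate n g m B" and r: "r = g * s + m" and "s > 0"
      using reduced_decomposition[OF E edge] .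
    have "s \<le> r" using g r by (cases g) auto
    with g r \<open>s > 0\<close> have "(s, g) \<in> I" by (simp add: I_def less_eq_div_iff_mult_less_eq)
    moreover have "B \<in> S s"
      using B conn connected_network_inflate[OF g] by (simp add: S_def E_eq)
    moreover have "E = f (s, g) B" using E_eq r by (simp add: f_def)
    ultimately show "E \<in> (\<Union>i\<in>I. f i ` S (fst i))" by force
  next
    fix E assume "E \<in> (\<Union>i\<in>I. f i ` S (fst i))"
    then obtain s g B where sg: "(s, g) \<in> I" and B: "B \<in> S s" and E: "E = inflate n g (r - g * s) B"
      by (auto simp: f_def)
    have "E \<in> networks n (g * s + (r - g * s))"
      unfolding E using B by (intro inflate_in_networks) (simp add: S_def)
    then show "E \<in> {E \<in> networks n r. connected_network n E}"
      using le[OF sg] B connected_network_inflate by (simp add: E S_def)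
  qed
  have "K n r = (\<Sum>i\<in>I. card (S (fst i) //
      {(E, E'). E \<in> S (fst i) \<and> E' \<in> S (fst i) \<and> network_iso n E E'}))"
    unfolding K_def card_up_to_iso_def
  proof (rule card_quotient_Sigma[where f = f, OF equivp_network_iso])
    show "finite I" by (simp add: I_def)
    show "finite (S (fst i))" for i using finite_networks by (simp add: S_def)
    fix i j E E' assume "i \<in> I" "j \<in> I" "E \<in> S (fst i)" "E' \<in> S (fst j)"
    moreover obtain s g t h where ij: "i = (s, g)" "j = (t, h)" by (cases i; cases j)
    ultimately have iff: "network_iso n (f i E) (f j E') \<longleftrightarrow>
        g = h \<and> r - g * s = r - h * t \<and> network_iso n E E'"
      using le by (simp add: f_def S_def network_iso_inflate_iff)
    \<comment> \<open>Truncated subtraction loses nothing, since \<open>g * s \<le> r\<close> on \<open>I\<close>.\<close>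
    have "s = t" if "g = h" "r - g * s = r - h * t"
    proof -
      have bounds: "g * s \<le> r" "h * t \<le> r" "g > 0"
        using le \<open>i \<in> I\<close> \<open>j \<in> I\<close> ij by auto
      with that(2) have "g * s = h * t" by linarith
      with that(1) bounds(3) show ?thesis by simp
    qed
    then show "network_iso n (f i E) (f j E') \<longleftrightarrow> i = j \<and> network_iso n E E'"
      unfolding iff unfolding ij by auto
  qed (fact T)
  also have "\<dots> = (\<Sum>(s, g)\<in>I. M n s)" by (simp add: M case_prod_unfold)
  also have "\<dots> = (\<Sum>s=1..r. \<Sum>g=1..r div s. M n s)"
    unfolding I_def by (rule sum.Sigma[symmetric]) auto
  finally show ?thesis by simp
qed

text \<open>The single vertex with \<open>r\<close> loops is the edgeless network inflated by \<open>r\<close> loops.\<close>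

lemma not_minimal_network_single_cell:
  assumes E: "E \<in> networks 1 r" and "r > 0"
  shows "\<not> minimal_network 1 r E"
proof
  assume min: "minimal_network 1 r E"
  let ?B = "\<lambda>_ _. 0 :: nat"
  have B: "?B \<in> networks 1 0" by (simp add: networks_def)
  have "E = inflate 1 1 r ?B"
    using E by (auto simp: networks_def inflate_def fun_eq_iff)
  then have "ode_equivalent 1 r E 0 ?B"
    using ode_equivalent_inflate[OF B, of 1 r] by simp
  then have "num_edges 1 E \<le> num_edges 1 ?B"
    using min B unfolding minimal_network_def by blast
  then show False unfolding num_edges_eq[OF E] num_edges_eq[OF B] using \<open>r > 0\<close> by simp
qed

theorem theorem3:
  shows "(\<forall>n\<ge>2. M n 1 = K n 1 \<and>
            (\<forall>r\<ge>2. int (M n r) =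
               int (K n r) - (\<Sum>s=1..r - 1. \<lfloor>real r / real s\<rfloor> * int (M n s))))
         \<and> (\<forall>r\<ge>1. M 1 r = 0)"
proof (intro conjI allI impI)
  fix n :: nat assume n: "n \<ge> 2"
  show "M n 1 = K n 1" using K_eq_sum_M[OF n, of 1] by simp
  fix r :: nat assume "r \<ge> 2"
  then obtain q where q: "r = Suc q" by (cases r) auto
  have "K n r = (\<Sum>s=1..q. (r div s) * M n s) + M n r"
    unfolding K_eq_sum_M[OF n] q by simp
  then show "int (M n r) = int (K n r) - (\<Sum>s=1..r - 1. \<lfloor>real r / real s\<rfloor> * int (M n s))"
    by (simp add: q floor_divide_of_nat_eq del: of_nat_Suc)
next
  fix r :: nat assume "r \<ge> 1"
  then have "{E \<in> networks 1 r. connected_network 1 E \<and> minimal_network 1 r E} = {}"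
    using not_minimal_network_single_cell by auto
  then show "M 1 r = 0" by (simp only: M_def card_up_to_iso_def quotient_empty card.empty)
qed

end
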